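(* Let $a,b$ be real numbers with $a<1$, $ab>1$ and $b$ an integer greater than $2$, and suppose that $\sum_{n=0}^{k-1}\epsilon_n(ab)^n=0$ for some positive integer $k$ and some $\epsilon_0,\dots,\epsilon_{k-1}\in\{-1,1\}$. Then there exists a weak tangent $E$ of $\Gamma_{T_{a,b}}$ such that $$\dim_{\mathrm{H}}E=\dim_{\mathrm{A}}\Gamma_{T_{a,b}}\ \geq\ \overline{\dim_{\mathrm{B}}}\,\Gamma_{T_{a,b}} .$$ Moreover, the last inequality can be strict, i.e. there exist real numbers $a,b$ with $a<1$, $ab>1$, $b$ an integer greater than $2$, and $\sum_{n=0}^{k-1}\epsilon_n(ab)^n=0$ for some positive integer $k$ and some $\epsilon_0,\dots,\epsilon_{k-1}\in\{-1,1\}$, for which $\dim_{\mathrm{A}}\Gamma_{T_{a,b}}>\overline{\dim_{\mathrm{B}}}\,\Gamma_{T_{a,b}}$.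
   Context: Let $T:\mathbb{R}\to\mathbb{R}$ be the tent map: the function of period $1$ with $T(x)=x$ for $x\in[0,\frac12]$ and $T(x)=1-x$ for $x\in[\frac12,1]$. The Takagi function is $T_{a,b}(x)=\sum_{n=0}^{\infty}a^nT(b^nx)$. For $f:\mathbb{R}\to\mathbb{R}$, the graph of $f$ over $[0,1]$ is $\Gamma_f=\{(x,y)\in\mathbb{R}^2: x\in[0,1],\ y=f(x)\}$. $\dim_{\mathrm{H}}$ denotes Hausdorff dimension. For a bounded set $F\subset\mathbb{R}^n$, $N_r(F)$ is the minimal number of balls of size $r>0$ needed to cover $F$; the upper box dimension is $\overline{\dim_{\mathrm{B}}}F=\limsup_{r\to0}\left(-\frac{\log N_r(F)}{\log r}\right)$; and the Assouad dimension is $$\dim_{\mathrm{A}}F=\inf\Big\{s\ge 0:\ \exists C>0\ \forall R>0\ \forall r\in(0,R)\ \forall x\in F:\ N_r(B(x,R)\cap F)\le C\Big(\frac Rr\Big)^s\Big\},$$ where $B(x,R)$ is the closed ball of centre $x$ and radius $R$. Weak tangents: let $X\subset\mathbb{R}^n$ be a fixed compact reference set, namely the closed unit ball or closed unit cube, and let $E,F\subset\mathbb{R}^n$ be compact. $E$ is a weak tangent of $F$ if there is a sequence of similarity maps $S_m:\mathbb{R}^n\to\mathbb{R}^n$ such that $d_{\mathcal{H}}(E,S_m(F)\cap X)\to0$ as $m\to\infty$. Here $d_{\mathcal{H}}$ is the Hausdorff metric on compact sets, $d_{\mathcal{H}}(A,B)=\inf\{\delta>0: A\subset B_\delta,\ B\subset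 A_\delta\}$ with $C_\delta=\{x\in\mathbb{R}^n: |x-y|<\delta\text{ for some }y\in C\}$. *)

theory Defs
  imports "HOL-Analysis.Analysis"
begin

section \<open>The Takagi function and its graph\<close>

definition tent :: "real \<Rightarrow> real" where
  "tent x = (if frac x \<le> 1/2 then frac x else 1 - frac x)"

lemma tent_periodic: "tent (x + 1) = tent x"
  by (simp add: tent_def frac_1_eq)

lemma tent_left: "0 \<le> x \<Longrightarrow> x \<le> 1/2 \<Longrightarrow> tent x = x"
  by (simp add: tent_def frac_eq)

lemma tent_right: "1/2 \<le> x \<Longrightarrow> x \<le> 1 \<Longrightarrow> tent x = 1 - x"
  by (cases "x = 1") (auto simp: tent_def frac_eq)

definition takagi :: "real \<Rightarrow> real \<Rightarrow> real \<Rightarrow> real" where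
  "takagi a b x = (\<Sum>n. a ^ n * tent (b ^ n * x))"

definition graph_unit :: "(real \<Rightarrow> real) \<Rightarrow> (real \<times> real) set" where
  "graph_unit f = {(x, y). x \<in> {0..1} \<and> y = f x}"

section \<open>Hausdorff dimension\<close>

text \<open>The conventions are that the diameter of the empty set to any power is \<open>0\<close>, and that
  a nonempty set has diameter to the power \<open>0\<close> equal to \<open>1\<close>; the latter is explicit
  because \<open>0 powr 0 = 0\<close>.\<close>

definition diam_power :: "real \<Rightarrow> 'a::metric_space set \<Rightarrow> ennreal" where
  "diam_power s U =
     (if U = {} then 0 else if s = 0 then 1 else ennreal (diameter U powr s))"

text \<open>Covers are indexed by \<open>nat\<close>; finite covers are padded with empty sets. Boundedness is
  required because \<open>diameter\<close> is only meaningful for bounded sets.\<close>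

definition hausdorff_premeasure :: "real \<Rightarrow> real \<Rightarrow> 'a::metric_space set \<Rightarrow> ennreal" where
  "hausdorff_premeasure s \<delta> F =
     (INF U \<in> {U :: nat \<Rightarrow> 'a set.
                 F \<subseteq> (\<Union>i. U i) \<and> (\<forall>i. bounded (U i) \<and> diameter (U i) \<le> \<delta>)}.
        \<Sum>i. diam_power s (U i))"

definition hausdorff_measure :: "real \<Rightarrow> 'a::metric_space set \<Rightarrow> ennreal" where
  "hausdorff_measure s F = (SUP \<delta> \<in> {0<..}. hausdorff_premeasure s \<delta> F)"

definition hausdorff_dim :: "'a::metric_space set \<Rightarrow> ereal" where
  "hausdorff_dim F = Inf {ereal s | s. 0 \<le> s \<and> hausdorff_measure s F = 0}"

section \<open>Upper box dimension and Assouad dimension\<close>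

text \<open>The covering balls are closed and may be centred anywhere in the space. The value is
  meaningful only if a finite cover exists, in particular for bounded subsets of a
  Euclidean space.\<close>

definition covering_number :: "real \<Rightarrow> 'a::metric_space set \<Rightarrow> nat" where
  "covering_number r F =
     (LEAST n. \<exists>C. finite C \<and> card C = n \<and> F \<subseteq> (\<Union>c\<in>C. cball c r))"

lemma finite_cover_exists:
  fixes F :: "'a::euclidean_space set"
  assumes "bounded F" and "0 < r"
  shows "\<exists>C. finite C \<and> F \<subseteq> (\<Union>c\<in>C. cball c r)"
proof -
  have "compact (closure F)"
    using assms(1) by (simp add: compact_closure)
  then have "\<forall>e>0. \<exists>k. finite k \<and> closure F \<subseteq> (\<Union>x\<in>k. ball x e)"
    by (simp add: compact_eq_totally_bounded)
  then obtain C where "finite C" and C: "closure F \<subseteq> (\<Union>c\<in>C. ball c r)"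
    using assms(2) by meson
  have "F \<subseteq> (\<Union>c\<in>C. cball c r)"
  proof
    fix x assume "x \<in> F"
    then have "x \<in> (\<Union>c\<in>C. ball c r)"
      using closure_subset C by (meson subsetD)
    then show "x \<in> (\<Union>c\<in>C. cball c r)" by force
  qed
  with \<open>finite C\<close> show ?thesis by blast
qed

definition upper_box_dim :: "'a::metric_space set \<Rightarrow> ereal" where
  "upper_box_dim F =
     Limsup (at_right 0) (\<lambda>r. ereal (- (ln (real (covering_number r F)) / ln r)))"

definition assouad_dim :: "'a::metric_space set \<Rightarrow> ereal" where
  "assouad_dim F = Inf {ereal s | s. 0 \<le> s \<and>
     (\<exists>C>0. \<forall>R>0. \<forall>r\<in>{0<..<R}. \<forall>x\<in>F.
        real (covering_number r (cball x R \<inter> F)) \<le> C * (R / r) powr s)}"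

section \<open>Weak tangents\<close>

text \<open>With values in \<open>ereal\<close>, the distance between the empty set and a nonempty set is
  \<open>\<infinity>\<close>.\<close>

definition open_nbhd :: "'a::metric_space set \<Rightarrow> real \<Rightarrow> 'a set" where
  "open_nbhd A \<delta> = {x. \<exists>y\<in>A. dist x y < \<delta>}"

definition hausdorff_dist :: "'a::metric_space set \<Rightarrow> 'a set \<Rightarrow> ereal" where
  "hausdorff_dist A B =
     Inf {ereal \<delta> | \<delta>. 0 < \<delta> \<and> A \<subseteq> open_nbhd B \<delta> \<and> B \<subseteq> open_nbhd A \<delta>}"

definition similarity :: "('a::metric_space \<Rightarrow> 'a) \<Rightarrow> bool" where
  "similarity S \<longleftrightarrow> (\<exists>c>0. \<forall>x y. dist (S x) (S y) = c * dist x y)"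

definition weak_tangent :: "'a::euclidean_space set \<Rightarrow> 'a set \<Rightarrow> 'a set \<Rightarrow> bool" where
  "weak_tangent X E F \<longleftrightarrow> compact E \<and> compact F \<and>
     (\<exists>S :: nat \<Rightarrow> 'a \<Rightarrow> 'a. (\<forall>m. similarity (S m)) \<and>
        (\<lambda>m. hausdorff_dist E (S m ` F \<inter> X)) \<longlonglongrightarrow> 0)"

section \<open>The condition on the parameters\<close>

definition takagi_condition :: "real \<Rightarrow> real \<Rightarrow> bool" where
  "takagi_condition a b \<longleftrightarrow> a < 1 \<and> a * b > 1 \<and> b \<in> \<int> \<and> b > 2 \<and>
     (\<exists>(k::nat) (\<epsilon>::nat \<Rightarrow> real). k > 0 \<and> (\<forall>n<k. \<epsilon> n \<in> {-1, 1}) \<and>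
        (\<Sum>n<k. \<epsilon> n * (a * b) ^ n) = 0)"

end

theory Submission
  imports Defs "HOL-Complex_Analysis.Great_Picard"
begin

text \<open>
  The first part holds for every nonempty compact \<open>F\<close> in the plane. For \<open>t\<close> below the Assouad
  dimension some ball of \<open>F\<close> needs too many small balls; among its dyadic cells at all levels,
  one on the deepest level where the cell still carries at least the share \<open>2 powr (- j * t)\<close>
  of the points is evenly filled: its subcells obey a discrete Frostman
  condition with exponent \<open>t\<close>. Blowing up such cells and taking a Hausdorff limit (Blaschke
  selection) gives a weak tangent on which the mass distribution principle forces the full
  dimension.

  For strictness take \<open>b = 16\<close> and \<open>a * b\<close> the golden ratio \<open>\<phi>\<close>. As \<open>1 + \<phi> - \<phi>\<^sup>2 = 0\<close>, the sum of
  the first three terms of the series is constant on the interval from \<open>8/4096\<close> to \<open>16/4096\<close>,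
  so the graph contains eight copies of itself at the same height, compressed by \<open>4096\<close>
  horizontally but only by \<open>4096 / \<phi> ^ 3\<close> vertically. Iterating, small pieces of the graph look
  like \<open>C \<times> [0,1]\<close> with \<open>C\<close> a Cantor set of dimension \<open>log 8 / log 4096 = 1/4\<close>, whereas the upper
  box dimension is at most \<open>1 + log 16 \<phi> < 5/4\<close>.
\<close>

section \<open>Covering numbers and dimensions\<close>

lemma covering_number_le:
  assumes "finite C" and "F \<subseteq> (\<Union>c\<in>C. cball c r)"
  shows "covering_number r F \<le> card C"
  unfolding covering_number_def by (rule Least_le) (use assms in blast)

lemma covering_number_attained:
  fixes F :: "'a::euclidean_space set"
  assumes "bounded F" and "0 < r"
  obtains C where "finite C" and "card C = covering_number r F"
    and "F \<subseteq> (\<Union>c\<in>C. cball c r)"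
proof -
  have "\<exists>n C. finite C \<and> card C = n \<and> F \<subseteq> (\<Union>c\<in>C. cball c r)"
    using finite_cover_exists[OF assms] by blast
  from LeastI_ex[OF this] that show ?thesis
    unfolding covering_number_def by blast
qed

text \<open>Centres need not lie in the covered set, so a cover of \<open>G\<close> serves
  \<open>F\<close> with the same radius.\<close>

lemma covering_number_mono:
  fixes F :: "'a::euclidean_space set"
  assumes "F \<subseteq> G" and "bounded G" and "0 < r" and "r \<le> r'"
  shows "covering_number r' F \<le> covering_number r G"
proof -
  obtain C where C: "finite C" "card C = covering_number r G" "G \<subseteq> (\<Union>c\<in>C. cball c r)"
    using covering_number_attained[OF assms(2,3)] .
  have "F \<subseteq> (\<Union>c\<in>C. cball c r')"
    using C(3) assms(1) subset_cball[OF assms(4)] by blast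
  from covering_number_le[OF C(1) this] C(2) show ?thesis by simp
qed

text \<open>A ball of radius \<open>r\<close> contains at most one point of \<open>P\<close>, so
  assigning to each point a centre near it is injective. Lower bounds on covering numbers come from
  this.\<close>

lemma card_separated_le_covering_number:
  fixes F :: "'a::euclidean_space set"
  assumes "P \<subseteq> F" and "bounded F" and "0 < r"
    and sep: "\<And>p q. p \<in> P \<Longrightarrow> q \<in> P \<Longrightarrow> p \<noteq> q \<Longrightarrow> 2 * r < dist p q"
  shows "card P \<le> covering_number r F"
proof -
  obtain C where C: "finite C" "card C = covering_number r F" "F \<subseteq> (\<Union>c\<in>C. cball c r)"
    using covering_number_attained[OF assms(2,3)] .
  have "\<forall>p\<in>P. \<exists>c\<in>C. dist c p \<le> r"
    using C(3) assms(1) unfolding subset_iff UN_iff mem_cball by blast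
  then obtain f where f: "\<And>p. p \<in> P \<Longrightarrow> f p \<in> C \<and> dist (f p) p \<le> r"
    by metis
  have "inj_on f P"
  proof (rule inj_onI, rule ccontr)
    fix p q assume pq: "p \<in> P" "q \<in> P" "f p = f q" "p \<noteq> q"
    have "dist p q \<le> dist (f p) p + dist (f q) q"
      using pq(3) by (metis dist_triangle3)
    also have "\<dots> \<le> 2 * r" using f[OF pq(1)] f[OF pq(2)] by simp
    finally show False using sep[OF pq(1,2,4)] by simp
  qed
  then show ?thesis
    using card_inj_on_le[of f P C] f C(1,2) by auto
qed

lemma covering_number_pos:
  fixes F :: "'a::euclidean_space set"
  assumes "F \<noteq> {}" and "bounded F" and "0 < r"
  shows "0 < covering_number r F"
proof -
  obtain C where C: "finite C" "card C = covering_number r F" "F \<subseteq> (\<Union>c\<in>C. cball c r)"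
    using covering_number_attained[OF assms(2,3)] .
  then have "C \<noteq> {}" using assms(1) by auto
  with C show ?thesis by (metis card_gt_0_iff)
qed

text \<open>Taking logarithms and dividing by \<open>ln r < 0\<close> bounds the quotient by
  \<open>- (ln K / ln r) + s\<close>, and the contribution of \<open>K\<close> vanishes as
  \<open>r\<close> tends to 0.\<close>

lemma upper_box_dim_le:
  fixes F :: "'a::euclidean_space set"
  assumes F: "F \<noteq> {}" "bounded F" and "0 < K"
    and le: "\<And>r. 0 < r \<Longrightarrow> r < 1 \<Longrightarrow> real (covering_number r F) \<le> K * (1 / r) powr s"
  shows "upper_box_dim F \<le> ereal s"
proof -
  have "((\<lambda>r. ereal (- (ln K / ln r) + s)) \<longlongrightarrow> ereal (0 + s)) (at_right 0)"
    using tendsto_minus[OF tendsto_divide_0[OF tendsto_const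
        filterlim_at_bot_imp_at_infinity[OF ln_at_0]], of "ln K"]
    by (intro tendsto_ereal tendsto_add tendsto_const) simp
  then have lim: "Limsup (at_right 0) (\<lambda>r. ereal (- (ln K / ln r) + s)) = ereal s"
    by (simp add: lim_imp_Limsup)
  have "eventually (\<lambda>r. r \<in> {0<..<1::real}) (at_right 0)"
    by (rule eventually_at_rightI[of 0 1]) auto
  then have "eventually (\<lambda>r. ereal (- (ln (real (covering_number r F)) / ln r))
      \<le> ereal (- (ln K / ln r) + s)) (at_right 0)"
  proof eventually_elim
    case (elim r)
    then have r: "0 < r" "r < 1" by auto
    have "ln (real (covering_number r F)) \<le> ln (K * (1 / r) powr s)"
      using le[OF r] covering_number_pos[OF F r(1)] r assms(3) by simp
    also have "\<dots> = ln K - s * ln r"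
      using r assms(3) by (simp add: ln_mult ln_powr ln_div)
    finally have "ln (real (covering_number r F)) \<le> ln K - s * ln r" .
    then have "- (ln (real (covering_number r F)) / ln r) \<le> - ((ln K - s * ln r) / ln r)"
      using r by (simp add: divide_right_mono_neg)
    also have "\<dots> = - (ln K / ln r) + s"
      using r by (simp add: diff_divide_distrib)
    finally show ?case by simp
  qed
  then have "upper_box_dim F \<le> Limsup (at_right 0) (\<lambda>r. ereal (- (ln K / ln r) + s))"
    unfolding upper_box_dim_def by (rule Limsup_mono)
  with lim show ?thesis by simp
qed

text \<open>One ball that contains the whole set turns the Assouad estimate into a box-counting
  bound; its radius only enters the constant.\<close>

lemma upper_box_dim_le_assouad_dim:
  fixes F :: "'a::euclidean_space set"
  assumes "F \<noteq> {}" and "bounded F"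
  shows "upper_box_dim F \<le> assouad_dim F"
  unfolding assouad_dim_def
proof (rule Inf_greatest, clarify)
  fix s C :: real
  assume C: "0 < C" "\<forall>R>0. \<forall>r\<in>{0<..<R}. \<forall>x\<in>F.
      real (covering_number r (cball x R \<inter> F)) \<le> C * (R / r) powr s"
  obtain x where x: "x \<in> F" using assms(1) by blast
  obtain R0 where R0: "F \<subseteq> cball x R0"
    using assms(2) bounded_any_center[of F x] by (auto simp: subset_iff)
  \<comment> \<open>The maximum with 1 makes every \<open>r < 1\<close> admissible as a radius below
    \<open>R\<close>.\<close>
  define R where "R = max R0 1"
  have R: "1 \<le> R" "cball x R \<inter> F = F" using R0 by (auto simp: R_def)
  show "upper_box_dim F \<le> ereal s"
  proof (rule upper_box_dim_le[OF assms])
    show "0 < C * R powr s" using C(1) R by simp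
    fix r :: real assume "0 < r" "r < 1"
    then have "real (covering_number r F) \<le> C * (R / r) powr s"
      using C(2)[rule_format, of R r x] R x by auto
    also have "\<dots> = C * R powr s * (1 / r) powr s"
      using R \<open>0 < r\<close> powr_mult[of R "1/r" s] by simp
    finally show "real (covering_number r F) \<le> C * R powr s * (1 / r) powr s" .
  qed
qed

text \<open>A ball of radius \<open>r\<close> has diameter at most \<open>2 * r\<close>, so a finite
  cover by equal balls, padded with empty sets of power 0, bounds the premeasure by the number of
  balls times \<open>(2 * r) powr s\<close>.\<close>

lemma hausdorff_measure_eq_0I:
  fixes E :: "'a::metric_space set"
  assumes "0 < s" and cover: "\<And>\<delta> \<epsilon> :: real. 0 < \<delta> \<Longrightarrow> 0 < \<epsilon> \<Longrightarrow>
    \<exists>C r. finite C \<and> 0 < r \<and> 2 * r \<le> \<delta> \<and> E \<subseteq> (\<Union>c\<in>C. cball c r) \<and> real (card C) * (2 * r) powr s \<le> \<epsilon>"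
  shows "hausdorff_measure s E = 0"
proof -
  have "hausdorff_premeasure s \<delta> E \<le> ennreal \<epsilon>" if de: "0 < \<delta>" "0 < \<epsilon>" for \<delta> \<epsilon> :: real
  proof -
    obtain C r where C: "finite C" "0 < r" "2 * r \<le> \<delta>" "E \<subseteq> (\<Union>c\<in>C. cball c r)"
      "real (card C) * (2 * r) powr s \<le> \<epsilon>"
      using cover[OF de] by blast
    define n where "n = card C"
    obtain f where f: "bij_betw f {..<n} C"
      using C(1) ex_bij_betw_nat_finite[of C] by (auto simp: n_def atLeast0LessThan)
    define U where "U i = (if i < n then cball (f i) r else {})" for i
    have d: "diameter (cball x r) \<le> 2 * r" for x :: 'a
    proof -
      have "dist y z \<le> 2 * r" if "y \<in> cball x r" "z \<in> cball x r" for y z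
        using that dist_triangle3[of y z x] by simp
      moreover have "x \<in> cball x r" using C(2) by simp
      ultimately show ?thesis
        unfolding diameter_def by (auto intro!: cSUP_least)
    qed
    have "E \<subseteq> (\<Union>i. U i)"
    proof
      fix x assume "x \<in> E"
      then obtain c where "c \<in> C" "x \<in> cball c r" using C(4) by blast
      moreover then obtain i where "i < n" "c = f i"
        using f by (auto simp: bij_betw_def)
      ultimately show "x \<in> (\<Union>i. U i)" by (auto simp: U_def)
    qed
    moreover have "bounded (U i) \<and> diameter (U i) \<le> \<delta>" for i
      using d[of "f i"] C(3) de(1) by (auto simp: U_def)
    ultimately have "hausdorff_premeasure s \<delta> E \<le> (\<Sum>i. diam_power s (U i))"
      unfolding hausdorff_premeasure_def by (intro INF_lower) auto
    also have "\<dots> = (\<Sum>i<n. diam_power s (U i))"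
      by (rule suminf_finite) (auto simp: U_def diam_power_def)
    also have "\<dots> \<le> (\<Sum>i<n. ennreal ((2 * r) powr s))"
    proof (rule sum_mono)
      fix i assume "i \<in> {..<n}"
      have "diameter (U i) powr s \<le> (2 * r) powr s"
        using d[of "f i"] C(2) assms(1) by (intro powr_mono2) (auto simp: U_def diameter_ge_0)
      then show "diam_power s (U i) \<le> ennreal ((2 * r) powr s)"
        using assms(1) by (auto simp: diam_power_def ennreal_leI)
    qed
    also have "\<dots> = ennreal (real n * (2 * r) powr s)"
      by (simp add: ennreal_mult ennreal_of_nat_eq_real_of_nat)
    also have "\<dots> \<le> ennreal \<epsilon>" using C(5) by (auto simp: n_def intro: ennreal_leI)
    finally show ?thesis .
  qed
  then have "hausdorff_premeasure s \<delta> E = 0" if "0 < \<delta>" for \<delta>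
    using that by (metis ennreal_le_epsilon add_0 le_zero_eq)
  then show ?thesis
    unfolding hausdorff_measure_def by (auto intro!: antisym SUP_least)
qed

section \<open>Upper bound for the Hausdorff dimension of weak tangents\<close>

lemma hausdorff_dist_lessD:
  fixes A B :: "'a::metric_space set"
  assumes "hausdorff_dist A B < ereal r"
  shows "A \<subseteq> open_nbhd B r \<and> B \<subseteq> open_nbhd A r"
proof -
  obtain d where d: "d < r" "A \<subseteq> open_nbhd B d" "B \<subseteq> open_nbhd A d"
    using assms unfolding hausdorff_dist_def Inf_less_iff by auto
  have "open_nbhd C d \<subseteq> open_nbhd C r" for C :: "'a set"
    using d(1) unfolding open_nbhd_def by (blast intro: less_trans)
  with d(2,3) show ?thesis by blast
qed

text \<open>The Assouad estimate depends only on the ratio of two radii, so it holds with the same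
  constant for every similar copy of \<open>F\<close>. A copy that is \<open>r\<close>-close to
  \<open>E\<close> passes its cover on to \<open>E\<close> after the radius is doubled.\<close>

lemma hausdorff_dim_weak_tangent_le:
  fixes F :: "'a::euclidean_space set"
  assumes "weak_tangent X E F" and "bounded X"
  shows "hausdorff_dim E \<le> assouad_dim F"
  unfolding assouad_dim_def
proof (rule Inf_greatest, clarify)
  fix s C :: real
  assume s: "0 \<le> s" and C: "0 < C" "\<forall>R>0. \<forall>r\<in>{0<..<R}. \<forall>x\<in>F.
      real (covering_number r (cball x R \<inter> F)) \<le> C * (R / r) powr s"
  obtain S where S: "\<And>m::nat. similarity (S m)"
    and lim: "(\<lambda>m. hausdorff_dist E (S m ` F \<inter> X)) \<longlonglongrightarrow> 0"
    and "compact F"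
    using assms(1) unfolding weak_tangent_def by blast
  obtain D where D: "0 < D" "X \<subseteq> cball 0 D"
    using assms(2) by (meson bounded_subset_ballD ball_subset_cball subset_trans)
  \<comment> \<open>Two points of \<open>X\<close> are at most \<open>2 * D\<close> apart, so the
    ball of this radius around one point of the copy in \<open>X\<close> contains all the
    others.\<close>
  define R0 where "R0 = 2 * D"
  have "0 < R0" using D by (simp add: R0_def)
  have cover: "\<exists>Q. finite Q \<and> E \<subseteq> (\<Union>c\<in>Q. cball c (2 * r)) \<and> real (card Q) \<le> C * (R0 / r) powr s"
    if r: "0 < r" "r < R0" for r
  proof -
    have "eventually (\<lambda>m. hausdorff_dist E (S m ` F \<inter> X) < ereal r) sequentially"
      using lim r(1) by (intro order_tendstoD) auto
    then obtain m where "hausdorff_dist E (S m ` F \<inter> X) < ereal r"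
      using eventually_happens'[OF sequentially_bot] by blast
    then have E: "E \<subseteq> open_nbhd (S m ` F \<inter> X) r"
      using hausdorff_dist_lessD by blast
    obtain l where l: "0 < l" "\<And>x y. dist (S m x) (S m y) = l * dist x y"
      using S[of m] unfolding similarity_def by blast
    show ?thesis
    proof (cases "S m ` F \<inter> X = {}")
      case True
      then have "E = {}" using E by (auto simp: open_nbhd_def)
      then show ?thesis using C(1) by (intro exI[of _ "{}"]) auto
    next
      case False
      then obtain x where x: "x \<in> F" "S m x \<in> X" by blast
      \<comment> \<open>Pulled back by \<open>S m\<close>, the radii \<open>R0\<close> and
        \<open>r\<close> become \<open>R0 / l\<close> and \<open>r / l\<close>, with the same
        ratio.\<close>
      define A where "A = cball x (R0 / l) \<inter> F"
      have "bounded A" unfolding A_def by (simp add: bounded_Int)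
      then obtain P where P: "finite P" "card P = covering_number (r / l) A"
        "A \<subseteq> (\<Union>c\<in>P. cball c (r / l))"
        using covering_number_attained[of A "r / l"] r l by auto
      have "E \<subseteq> (\<Union>c\<in>S m ` P. cball c (2 * r))"
      proof
        fix e assume "e \<in> E"
        then obtain y where y: "y \<in> F" "S m y \<in> X" "dist e (S m y) < r"
          using E by (auto simp: open_nbhd_def)
        have "dist (S m x) (S m y) \<le> dist (S m x) 0 + dist (S m y) 0"
          by (rule dist_triangle2)
        also have "\<dots> \<le> R0"
        proof -
          have "dist z 0 \<le> D" if "z \<in> X" for z
            using that D(2) by (auto simp: subset_iff dist_norm)
          then show ?thesis using add_mono[of "dist (S m x) 0" D "dist (S m y) 0" D] x(2) y(2) by (simp add: R0_def)
        qed
        finally have "y \<in> A" using y(1) l by (simp add: A_def field_simps)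
        then obtain c where c: "c \<in> P" "dist c y \<le> r / l" using P(3) unfolding subset_iff UN_iff mem_cball by blast
        then have "dist (S m c) (S m y) \<le> r" using l by (simp add: field_simps)
        then have "dist (S m c) e \<le> 2 * r"
          using y(3) dist_triangle2[of "S m c" e "S m y"] by simp
        with c(1) show "e \<in> (\<Union>c\<in>S m ` P. cball c (2 * r))" by auto
      qed
      moreover have "real (card (S m ` P)) \<le> C * (R0 / r) powr s"
      proof -
        have "real (card (S m ` P)) \<le> real (covering_number (r / l) A)"
          using P card_image_le[of P "S m"] by simp
        also have "\<dots> \<le> C * ((R0 / l) / (r / l)) powr s"
          using C(2)[rule_format, of "R0 / l" "r / l" x] \<open>0 < R0\<close> r l x(1)
          by (simp add: A_def field_simps)
        finally show ?thesis using l by simp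
      qed
      ultimately show ?thesis using P(1) by blast
    qed
  qed
  show "hausdorff_dim E \<le> ereal s"
  proof (rule ereal_le_epsilon2)
    fix e :: real assume e: "0 < e"
    have "hausdorff_measure (s + e) E = 0"
    proof (rule hausdorff_measure_eq_0I)
      show "0 < s + e" using s e by simp
      fix \<delta> \<epsilon> :: real assume de: "0 < \<delta>" "0 < \<epsilon>"
      \<comment> \<open>The balls covering \<open>E\<close> have radius \<open>2 * r\<close>, hence
        the power of 4. Their total power is at most \<open>M * r powr e\<close>, and the spare
        exponent \<open>e\<close> drives this to 0.\<close>
      define M where "M = C * R0 powr s * 4 powr (s + e)"
      have "eventually (\<lambda>r::real. 0 \<le> r) (at_right 0)"
        using eventually_at_right_less by (rule eventually_mono) simp
      then have "((\<lambda>r::real. M * r powr e) \<longlongrightarrow> M * 0) (at_right 0)"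
        using e by (intro tendsto_mult tendsto_const tendsto_zero_powrI) auto
      then have "eventually (\<lambda>r. M * r powr e < \<epsilon>) (at_right 0)"
        using de by (intro order_tendstoD) auto
      moreover have "eventually (\<lambda>r. r \<in> {0<..<min R0 (\<delta> / 4)}) (at_right 0)"
        by (rule eventually_at_rightI[of 0 "min R0 (\<delta> / 4)"]) (use \<open>0 < R0\<close> de in auto)
      ultimately have "eventually (\<lambda>r. M * r powr e < \<epsilon> \<and> r \<in> {0<..<min R0 (\<delta> / 4)}) (at_right 0)"
        by (rule eventually_conj)
      then obtain r where "M * r powr e < \<epsilon> \<and> r \<in> {0<..<min R0 (\<delta> / 4)}"
        using eventually_happens'[OF trivial_limit_at_right_real] by blast
      then have r: "0 < r" "r < R0" "r < \<delta> / 4" "M * r powr e < \<epsilon>" by auto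
      have "C * (R0 / r) powr s * (2 * (2 * r)) powr (s + e) = M * r powr e"
      proof -
        have "(2 * (2 * r)) powr (s + e) = 4 powr (s + e) * (r powr s * r powr e)"
          using r(1) powr_mult[of 4 r "s + e"] by (simp add: powr_add)
        moreover have "(R0 / r) powr s = R0 powr s / r powr s"
          using r(1) \<open>0 < R0\<close> by (simp add: powr_divide)
        ultimately show ?thesis using r(1) by (simp add: M_def)
      qed
      obtain Q where Q: "finite Q" "E \<subseteq> (\<Union>c\<in>Q. cball c (2 * r))"
        "real (card Q) \<le> C * (R0 / r) powr s"
        using cover[OF r(1,2)] by blast
      have "real (card Q) * (2 * (2 * r)) powr (s + e) \<le> \<epsilon>"
        using mult_right_mono[OF Q(3), of "(2 * (2 * r)) powr (s + e)"] r(4) \<open>_ = M * r powr e\<close> by simp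
      with Q r show "\<exists>C r. finite C \<and> 0 < r \<and> 2 * r \<le> \<delta> \<and> E \<subseteq> (\<Union>c\<in>C. cball c r) \<and>
          real (card C) * (2 * r) powr (s + e) \<le> \<epsilon>"
        by (intro exI[of _ Q] exI[of _ "2 * r"]) auto
    qed
    then show "hausdorff_dim E \<le> ereal s + ereal e"
      unfolding hausdorff_dim_def using s e by (intro Inf_lower) auto
  qed
qed

section \<open>Hausdorff limits and mass distribution\<close>

text \<open>The distance functions of the sets \<open>K n\<close> are uniformly bounded and
  1-Lipschitz on \<open>X\<close>. Arzela-Ascoli gives a uniformly convergent subsequence, and the
  zero set of its limit \<open>g\<close> is the Hausdorff limit.\<close>

lemma Blaschke_selection:
  fixes K :: "nat \<Rightarrow> 'a::euclidean_space set"
  assumes X: "compact X" and K: "\<And>n. compact (K n)" "\<And>n. K n \<noteq> {}" "\<And>n. K n \<subseteq> X"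
  obtains E r where "compact E" "E \<noteq> {}" "strict_mono (r :: nat \<Rightarrow> nat)"
    "(\<lambda>n. hausdorff_dist E (K (r n))) \<longlonglongrightarrow> 0"
proof -
  obtain B where B: "\<And>x. x \<in> X \<Longrightarrow> norm x \<le> B"
    using compact_imp_bounded[OF X] by (auto simp: bounded_iff)
  have "norm (infdist x (K n)) \<le> 2 * B" if x: "x \<in> X" for n x
  proof -
    obtain y where y: "y \<in> K n" using K(2) by blast
    have "infdist x (K n) \<le> dist x y" using y by (rule infdist_le)
    also have "\<dots> \<le> norm x + norm y" unfolding dist_norm by (rule norm_triangle_ineq4)
    also have "\<dots> \<le> 2 * B" using B[OF x] B[of y] K(3) y by fastforce
    finally show ?thesis by (simp add: infdist_nonneg)
  qed
  moreover have "\<exists>d>0. \<forall>n y. y \<in> X \<and> norm (x - y) < d \<longrightarrow>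
      norm (infdist x (K n) - infdist y (K n)) < e" if "0 < e" for x and e :: real
    using that infdist_triangle_abs[of x _ y for y]
    by (intro exI[of _ e]) (auto simp: dist_norm intro: le_less_trans)
  ultimately obtain g r where g: "continuous_on X g" and r: "strict_mono (r :: nat \<Rightarrow> nat)"
    and conv: "\<And>e. 0 < e \<Longrightarrow> \<exists>N. \<forall>n x. n \<ge> N \<and> x \<in> X \<longrightarrow> norm (infdist x (K (r n)) - g x) < e"
    using Arzela_Ascoli[OF X, of "\<lambda>n x. infdist x (K n)" "2 * B"] by (metis (no_types, lifting))
  have ptw: "(\<lambda>n. infdist x (K (r n))) \<longlonglongrightarrow> g x" if "x \<in> X" for x
    unfolding LIMSEQ_iff using conv that by blast
  define E where "E = {x \<in> X. g x = 0}"
  have "closedin (top_of_set X) E"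
    unfolding E_def using continuous_closedin_preimage_constant[OF g] .
  then have cE: "compact E" using X closedin_compact by blast
  \<comment> \<open>The points of \<open>K (r n)\<close> nearest to \<open>x\<close> accumulate at
    some \<open>e\<close>; passing to the limit gives both \<open>dist x e = g x\<close> and
    \<open>g e = 0\<close>. This yields that \<open>E\<close> is nonempty and that
    \<open>K (r n)\<close> is close to \<open>E\<close>.\<close>
  have near: "\<exists>e\<in>E. dist x e \<le> g x" if x: "x \<in> X" for x
  proof -
    have "\<exists>y. y \<in> K (r n) \<and> infdist x (K (r n)) = dist x y" for n
      using infdist_attains_inf[OF compact_imp_closed[OF K(1)] K(2), of "r n" x] by blast
    then obtain y where y: "\<And>n. y n \<in> K (r n)" "\<And>n. infdist x (K (r n)) = dist x (y n)"
      by metis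
    then have "\<forall>n. y n \<in> X" using K(3) by blast
    then obtain e q where e: "e \<in> X" and q: "strict_mono (q :: nat \<Rightarrow> nat)" "(y \<circ> q) \<longlonglongrightarrow> e"
      using X unfolding compact_def by metis
    have "(\<lambda>n. dist x ((y \<circ> q) n)) \<longlonglongrightarrow> dist x e"
      using q(2) by (intro tendsto_intros)
    moreover have "(\<lambda>n. dist x ((y \<circ> q) n)) \<longlonglongrightarrow> g x"
      using LIMSEQ_subseq_LIMSEQ[OF ptw[OF x] q(1)] y(2) by (simp add: o_def)
    ultimately have "dist x e = g x" by (rule LIMSEQ_unique)
    have "(\<lambda>n. infdist e (K (r (q n)))) \<longlonglongrightarrow> g e"
      using LIMSEQ_subseq_LIMSEQ[OF ptw[OF e] q(1)] by (simp add: o_def)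
    moreover have "(\<lambda>n. infdist e (K (r (q n)))) \<longlonglongrightarrow> 0"
    proof (rule tendsto_sandwich[of "\<lambda>_. 0" _ _ "\<lambda>n. dist e ((y \<circ> q) n)"])
      have "(\<lambda>n. dist e ((y \<circ> q) n)) \<longlonglongrightarrow> dist e e"
        using q(2) by (intro tendsto_intros)
      then show "(\<lambda>n. dist e ((y \<circ> q) n)) \<longlonglongrightarrow> 0" by simp
      show "\<forall>\<^sub>F n in sequentially. infdist e (K (r (q n))) \<le> dist e ((y \<circ> q) n)"
        using y(1) by (intro always_eventually allI) (simp add: infdist_le)
    qed (auto simp: infdist_nonneg)
    ultimately have "g e = 0" by (rule LIMSEQ_unique)
    with e \<open>dist x e = g x\<close> show ?thesis unfolding E_def by (intro bexI[of _ e]) auto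
  qed
  obtain x0 where "x0 \<in> K 0" using K(2) by blast
  then have "E \<noteq> {}" using near[of x0] K(3) by blast
  have lim: "(\<lambda>n. hausdorff_dist E (K (r n))) \<longlonglongrightarrow> 0"
  proof (rule order_tendstoI)
    fix a :: ereal assume "a < 0"
    then have "a < hausdorff_dist E (K (r n))" for n
      unfolding hausdorff_dist_def by (rule less_le_trans) (auto intro!: Inf_greatest)
    then show "\<forall>\<^sub>F n in sequentially. a < hausdorff_dist E (K (r n))" by simp
  next
    fix a :: ereal assume "0 < a"
    then obtain e where e: "0 < e" "ereal e < a"
      using ereal_dense2[of 0 a] by auto
    obtain N where N: "\<And>n x. n \<ge> N \<Longrightarrow> x \<in> X \<Longrightarrow> norm (infdist x (K (r n)) - g x) < e"
      using conv[OF e(1)] by blast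
    have "hausdorff_dist E (K (r n)) \<le> ereal e" if n: "n \<ge> N" for n
    proof -
      have "E \<subseteq> open_nbhd (K (r n)) e"
      proof
        fix x assume "x \<in> E"
        then have "infdist x (K (r n)) < e" using N[OF n, of x] by (auto simp: E_def)
        moreover obtain y where "y \<in> K (r n)" "infdist x (K (r n)) = dist x y"
          using infdist_attains_inf[OF compact_imp_closed[OF K(1)] K(2), of "r n" x] by blast
        ultimately show "x \<in> open_nbhd (K (r n)) e" by (auto simp: open_nbhd_def)
      qed
      moreover have "K (r n) \<subseteq> open_nbhd E e"
      proof
        fix x assume x: "x \<in> K (r n)"
        then have "x \<in> X" using K(3) by blast
        then have "g x < e" using N[OF n, of x] x by simp
        then show "x \<in> open_nbhd E e"
          using near[OF \<open>x \<in> X\<close>] by (auto simp: open_nbhd_def intro: le_less_trans)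
      qed
      ultimately show ?thesis
        unfolding hausdorff_dist_def using e(1) by (intro Inf_lower) blast
    qed
    then show "\<forall>\<^sub>F n in sequentially. hausdorff_dist E (K (r n)) < a"
      using e(2) unfolding eventually_sequentially by (meson le_less_trans)
  qed
  show ?thesis using that[OF cE \<open>E \<noteq> {}\<close> r lim] .
qed

text \<open>Each nonempty covering set lies in an open ball of slightly larger radius than its
  diameter. The errors \<open>\<epsilon> / 2 * (1/2) ^ Suc i\<close> sum to
  \<open>\<epsilon> / 2\<close>, and compactness leaves finitely many balls.\<close>

lemma hausdorff_measure_0_finite_cover:
  fixes E :: "'a::metric_space set"
  assumes E: "compact E" and s: "0 \<le> s" and null: "hausdorff_measure s E = 0" and "0 < \<epsilon>"
  obtains I :: "nat set" and x \<rho> where "finite I" "\<And>i. i \<in> I \<Longrightarrow> 0 < \<rho> i"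
    "E \<subseteq> (\<Union>i\<in>I. ball (x i) (\<rho> i))" "(\<Sum>i\<in>I. \<rho> i powr s) < \<epsilon>"
proof -
  have "hausdorff_premeasure s 1 E \<le> hausdorff_measure s E"
    unfolding hausdorff_measure_def by (intro SUP_upper) auto
  then have "hausdorff_premeasure s 1 E < ennreal (\<epsilon> / 2)"
    using null \<open>0 < \<epsilon>\<close> by simp
  then obtain U :: "nat \<Rightarrow> 'a set" where U: "E \<subseteq> (\<Union>i. U i)" "\<And>i. bounded (U i)"
    and sum: "(\<Sum>i. diam_power s (U i)) < ennreal (\<epsilon> / 2)"
    unfolding hausdorff_premeasure_def INF_less_iff by blast
  have "\<exists>x \<rho>. 0 < \<rho> \<and> U i \<subseteq> ball x \<rho> \<and> ennreal (\<rho> powr s) \<le> diam_power s (U i) + ennreal (\<epsilon> / 2 * (1/2) ^ Suc i)"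
    if ne: "U i \<noteq> {}" for i
  proof -
    obtain x where x: "x \<in> U i" using ne by blast
    define d where "d = diameter (U i)"
    have d: "0 \<le> d" unfolding d_def by (rule diameter_ge_0[OF U(2)])
    define \<eta> where "\<eta> = \<epsilon> / 2 * (1/2) ^ Suc i"
    have "0 < \<eta>" using \<open>0 < \<epsilon>\<close> by (simp add: \<eta>_def)
    have "\<exists>\<rho>>d. \<rho> powr s \<le> (if s = 0 then 1 else d powr s) + \<eta>"
    \<comment> \<open>For exponent 0 every positive radius has power 1; for positive exponents the
      radius comes from continuity of \<open>powr\<close> at \<open>d\<close>, which may be
      0.\<close>
    proof (cases "s = 0")
      case True
      then show ?thesis using d \<open>0 < \<eta>\<close> by (intro exI[of _ "d + 1"]) auto
    next
      case False
      have "((\<lambda>\<rho>. \<rho> powr s) \<longlongrightarrow> d powr s) (at_right d)"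
        using d False s eventually_mono[OF eventually_at_right_less[of d], of "\<lambda>x. 0 \<le> x"]
        by (intro tendsto_powr') (auto intro!: tendsto_eq_intros)
      then have "\<forall>\<^sub>F \<rho> in at_right d. \<rho> powr s < d powr s + \<eta>"
        using \<open>0 < \<eta>\<close> by (intro order_tendstoD) auto
      then have "\<forall>\<^sub>F \<rho> in at_right d. \<rho> powr s < d powr s + \<eta> \<and> d < \<rho>"
        using eventually_at_right_less by (rule eventually_conj)
      then obtain \<rho> where "\<rho> powr s < d powr s + \<eta> \<and> d < \<rho>"
        using eventually_happens'[OF trivial_limit_at_right_real] by blast
      then show ?thesis using False by (intro exI[of _ \<rho>]) auto
    qed
    then obtain \<rho> where \<rho>: "d < \<rho>" "\<rho> powr s \<le> (if s = 0 then 1 else d powr s) + \<eta>" by blast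
    have "U i \<subseteq> ball x \<rho>"
      using diameter_bounded_bound[OF U(2) x] \<rho>(1) unfolding d_def by (force intro: le_less_trans)
    moreover have "ennreal (\<rho> powr s) \<le> diam_power s (U i) + ennreal \<eta>"
    proof -
      have "diam_power s (U i) = ennreal (if s = 0 then 1 else d powr s)"
        using ne by (simp add: diam_power_def d_def)
      then show ?thesis
        using ennreal_leI[OF \<rho>(2)] \<open>0 < \<eta>\<close> by (simp split: if_splits)
    qed
    ultimately show ?thesis using \<rho>(1) d unfolding \<eta>_def
      by (intro exI[of _ x] exI[of _ \<rho>] conjI) (assumption | linarith)+
  qed
  then obtain x \<rho> where x\<rho>: "\<And>i. U i \<noteq> {} \<Longrightarrow> 0 < \<rho> i \<and> U i \<subseteq> ball (x i) (\<rho> i) \<and>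
      ennreal (\<rho> i powr s) \<le> diam_power s (U i) + ennreal (\<epsilon> / 2 * (1/2) ^ Suc i)"
    by metis
  obtain I where I: "I \<subseteq> {i. U i \<noteq> {}}" "finite I" "E \<subseteq> (\<Union>i\<in>I. ball (x i) (\<rho> i))"
  proof (rule compactE_image[OF E, of "{i. U i \<noteq> {}}" "\<lambda>i. ball (x i) (\<rho> i)"])
    show "E \<subseteq> (\<Union>i\<in>{i. U i \<noteq> {}}. ball (x i) (\<rho> i))"
      using U(1) x\<rho> by blast
  qed auto
  have "ennreal (\<Sum>i\<in>I. \<rho> i powr s) = (\<Sum>i\<in>I. ennreal (\<rho> i powr s))"
    by (rule sum_ennreal[symmetric]) simp
  also have "\<dots> \<le> (\<Sum>i\<in>I. diam_power s (U i) + ennreal (\<epsilon> / 2 * (1/2) ^ Suc i))"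
    using I(1) x\<rho> by (intro sum_mono) blast
  also have "\<dots> \<le> (\<Sum>i. diam_power s (U i) + ennreal (\<epsilon> / 2 * (1/2) ^ Suc i))"
    by (intro sum_le_suminf I) auto
  also have "\<dots> = (\<Sum>i. diam_power s (U i)) + (\<Sum>i. ennreal (\<epsilon> / 2 * (1/2) ^ Suc i))"
    by (rule suminf_add[symmetric]) auto
  also have "(\<Sum>i. ennreal (\<epsilon> / 2 * (1/2) ^ Suc i)) = ennreal (\<epsilon> / 2)"
    using \<open>0 < \<epsilon>\<close> sums_mult[OF power_half_series, of "\<epsilon> / 2"]
    by (intro suminf_ennreal_eq) auto
  also have "(\<Sum>i. diam_power s (U i)) + ennreal (\<epsilon> / 2) < ennreal (\<epsilon> / 2) + ennreal (\<epsilon> / 2)"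
    using sum by (simp add: ennreal_add_left_cancel_less add.commute)
  also have "\<dots> = ennreal \<epsilon>"
    using \<open>0 < \<epsilon>\<close> by (simp flip: ennreal_plus)
  finally have "(\<Sum>i\<in>I. \<rho> i powr s) < \<epsilon>"
    using \<open>0 < \<epsilon>\<close> by (simp add: ennreal_less_iff sum_nonneg)
  moreover have "0 < \<rho> i" if "i \<in> I" for i using that I(1) x\<rho> by blast
  ultimately show ?thesis using that I(2,3) by blast
qed

text \<open>A mass distribution principle for the normalised counting measures on
  \<open>P n\<close>: a cover of \<open>E\<close> by balls with small power sum also covers
  \<open>P n\<close> for large \<open>n\<close>, yet would carry mass below 1. Finite sets cannot
  satisfy such a bound at arbitrarily small scales when \<open>u > 0\<close>, hence the cut-off
  \<open>inverse (real (Suc n))\<close>.\<close>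

lemma hausdorff_dim_ge_of_discrete_Frostman:
  fixes E :: "'a::euclidean_space set"
  assumes E: "compact E" and P: "\<And>n. P n \<subseteq> K n" "\<And>n. finite (P n)" "\<And>n. P n \<noteq> {}"
    and lim: "(\<lambda>n. hausdorff_dist E (K n)) \<longlonglongrightarrow> 0"
    and d: "0 < d" and A: "0 < A"
    and Frostman: "\<And>u. 0 \<le> u \<Longrightarrow> ereal u < s \<Longrightarrow> eventually (\<lambda>n. \<forall>x \<rho>. inverse (real (Suc n)) \<le> \<rho> \<and> \<rho> \<le> d \<longrightarrow>
        real (card (P n \<inter> ball x \<rho>)) \<le> A * (\<rho> / d) powr u * real (card (P n))) sequentially"
  shows "s \<le> hausdorff_dim E"
  unfolding hausdorff_dim_def
proof (rule Inf_greatest, clarify, rule ccontr)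
  fix u :: real assume u: "0 \<le> u" "hausdorff_measure u E = 0" "\<not> s \<le> ereal u"
  \<comment> \<open>The first entry keeps all radii at most \<open>d\<close>, where the Frostman
    bound is available; the second makes the total mass less than 1.\<close>
  define \<epsilon> where "\<epsilon> = min (d powr u) (d powr u / A)"
  have "0 < \<epsilon>" using d A by (simp add: \<epsilon>_def)
  obtain I :: "nat set" and x \<rho> where I: "finite I" "\<And>i. i \<in> I \<Longrightarrow> 0 < \<rho> i"
    "E \<subseteq> (\<Union>i\<in>I. ball (x i) (\<rho> i))" and sum: "(\<Sum>i\<in>I. \<rho> i powr u) < \<epsilon>"
    using hausdorff_measure_0_finite_cover[OF E u(1,2) \<open>0 < \<epsilon>\<close>] by metis
  define G where "G = (\<Union>i\<in>I. ball (x i) (\<rho> i))"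
  have "open G" unfolding G_def by auto
  then obtain \<delta> where \<delta>: "0 < \<delta>" "\<And>y z. y \<in> E \<Longrightarrow> dist y z < \<delta> \<Longrightarrow> z \<in> G"
  proof -
    have "\<exists>\<delta>>0. (\<Union>x\<in>E. cball x \<delta>) \<subseteq> G"
      using compact_subset_open_imp_cball_epsilon_subset[OF E \<open>open G\<close>] I(3) by (metis G_def)
    then show ?thesis using that by (force simp: subset_iff)
  qed
  have small: "\<rho> i \<le> d" if "i \<in> I" for i
  proof (rule ccontr)
    assume "\<not> \<rho> i \<le> d"
    then have "d powr u \<le> \<rho> i powr u" using d u(1) by (intro powr_mono2) auto
    also have "\<dots> \<le> (\<Sum>i\<in>I. \<rho> i powr u)" using that I(1) by (intro member_le_sum) auto
    finally show False using sum by (simp add: \<epsilon>_def)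
  qed
  \<comment> \<open>Finiteness of the cover matters here: all its radii eventually exceed the
    cut-off.\<close>
  have "eventually (\<lambda>n. \<forall>i\<in>I. inverse (real (Suc n)) \<le> \<rho> i) sequentially"
    using I(1)
  proof (rule eventually_ball_finite)
    show "\<forall>i\<in>I. eventually (\<lambda>n. inverse (real (Suc n)) \<le> \<rho> i) sequentially"
    proof
      fix i assume "i \<in> I"
      with I(2) LIMSEQ_inverse_real_of_nat have "eventually (\<lambda>n. inverse (real (Suc n)) < \<rho> i) sequentially"
        by (intro order_tendstoD) auto
      then show "eventually (\<lambda>n. inverse (real (Suc n)) \<le> \<rho> i) sequentially"
        by (rule eventually_mono) simp
    qed
  qed
  moreover have "eventually (\<lambda>n. hausdorff_dist E (K n) < ereal \<delta>) sequentially"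
    using lim \<delta>(1) by (intro order_tendstoD) auto
  moreover have "eventually (\<lambda>n. \<forall>x \<rho>. inverse (real (Suc n)) \<le> \<rho> \<and> \<rho> \<le> d \<longrightarrow>
        real (card (P n \<inter> ball x \<rho>)) \<le> A * (\<rho> / d) powr u * real (card (P n))) sequentially"
    using Frostman u by simp
  ultimately have "eventually (\<lambda>n. False) sequentially"
  proof eventually_elim
    case (elim n)
    have "P n \<subseteq> G"
      using P(1)[of n] hausdorff_dist_lessD[OF elim(2)] \<delta>(2)
      by (force simp: open_nbhd_def subset_iff dist_commute)
    then have "P n = (\<Union>i\<in>I. P n \<inter> ball (x i) (\<rho> i))" by (auto simp: G_def)
    then have "real (card (P n)) = real (card (\<Union>i\<in>I. P n \<inter> ball (x i) (\<rho> i)))" by simp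
    also have "\<dots> \<le> real (\<Sum>i\<in>I. card (P n \<inter> ball (x i) (\<rho> i)))"
      using I(1) by (intro of_nat_mono card_UN_le)
    also have "\<dots> \<le> (\<Sum>i\<in>I. A * (\<rho> i / d) powr u * real (card (P n)))"
      unfolding of_nat_sum using elim(1,3) small by (intro sum_mono) blast
    also have "\<dots> = A / d powr u * (\<Sum>i\<in>I. \<rho> i powr u) * real (card (P n))"
    proof -
      have "A * (\<rho> i / d) powr u * real (card (P n)) = A / d powr u * real (card (P n)) * \<rho> i powr u"
        if "i \<in> I" for i
        using I(2)[OF that] d by (simp add: powr_divide)
      then show ?thesis by (simp add: sum_distrib_left sum_distrib_right mult_ac)
    qed
    also have "\<dots> < 1 * real (card (P n))"
    proof (rule mult_strict_right_mono)
      have "(\<Sum>i\<in>I. \<rho> i powr u) < d powr u / A" using sum by (simp add: \<epsilon>_def)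
      then show "A / d powr u * (\<Sum>i\<in>I. \<rho> i powr u) < 1"
        using A d by (simp add: field_simps)
      show "0 < real (card (P n))" using P(2,3) by (simp add: card_gt_0_iff)
    qed
    finally show False by simp
  qed
  then show False by simp
qed

section \<open>Weak tangents of full dimension\<close>

text \<open>Here \<open>c j p\<close> stands for the label of the level-\<open>j\<close> cell of
  \<open>p\<close>. Level 0 carries its full share, so a deepest level up to \<open>N\<close>
  exists; it controls \<open>L\<close> further levels unless fewer than \<open>L\<close> levels
  remain below \<open>N + 1\<close>, which is the outcome \<open>deep\<close>.\<close>

lemma exists_equidistributed_cell:
  fixes c :: "nat \<Rightarrow> 'a \<Rightarrow> 'b" and t :: real
  assumes "finite P" and "p0 \<in> P"
  defines "D j p \<equiv> {q \<in> P. c j q = c j p}"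
  obtains (good) j p where "p \<in> P" "\<And>k q. k \<le> L \<Longrightarrow> q \<in> D j p \<Longrightarrow>
      real (card (D (j + k) q)) \<le> 2 powr (- real k * t) * real (card (D j p))"
  | (deep) j p where "p \<in> P" "j \<le> N" "N < j + L"
      "2 powr (- real j * t) * real (card (D 0 p0)) \<le> real (card (D j p))"
proof -
  define H where "H j \<longleftrightarrow> (\<exists>p\<in>P. 2 powr (- real j * t) * real (card (D 0 p0)) \<le> real (card (D j p)))" for j
  define J where "J = {j. j \<le> N \<and> H j}"
  have "finite J" unfolding J_def by simp
  have "H 0" using \<open>p0 \<in> P\<close> by (auto simp: H_def)
  then have "0 \<in> J" by (simp add: J_def)
  define j where "j = Max J"
  have "j \<in> J" unfolding j_def using \<open>finite J\<close> \<open>0 \<in> J\<close> by (intro Max_in) auto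
  then have "j \<le> N" "H j" by (auto simp: J_def)
  then obtain p where p: "p \<in> P" "2 powr (- real j * t) * real (card (D 0 p0)) \<le> real (card (D j p))"
    unfolding H_def by blast
  show ?thesis
  proof (cases "N < j + L")
    case True
    then show ?thesis using deep p \<open>j \<le> N\<close> by blast
  next
    case False
    show ?thesis
    proof (rule good[OF p(1)], rule ccontr)
      fix k q
      assume k: "k \<le> L" "q \<in> D j p"
        and bad: "\<not> real (card (D (j + k) q)) \<le> 2 powr (- real k * t) * real (card (D j p))"
      \<comment> \<open>An overfull subcell would put \<open>j + k\<close> into \<open>J\<close>.
        Maximality then forces \<open>k = 0\<close>, where both sides of the bound agree.\<close>
      have "2 powr (- real (j + k) * t) * real (card (D 0 p0))
          = 2 powr (- real k * t) * (2 powr (- real j * t) * real (card (D 0 p0)))"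
        by (simp add: powr_add[symmetric] algebra_simps)
      also have "\<dots> \<le> 2 powr (- real k * t) * real (card (D j p))"
        using p(2) by (intro mult_left_mono) auto
      finally have "H (j + k)" unfolding H_def using bad k(2) by (intro bexI[of _ q]) (auto simp: D_def)
      then have "j + k \<in> J" using k(1) False by (simp add: J_def)
      then have "j + k \<le> j" unfolding j_def using \<open>finite J\<close> by (rule Max_ge[rotated])
      then have "k = 0" by simp
      moreover have "D j q = D j p" using k(2) by (simp add: D_def)
      ultimately show False using bad by simp
    qed
  qed
qed

section \<open>Half-open dyadic squares in the plane\<close>

definition cell :: "nat \<Rightarrow> real \<times> real \<Rightarrow> int \<times> int" where
  "cell k z = (\<lfloor>2 ^ k * fst z\<rfloor>, \<lfloor>2 ^ k * snd z\<rfloor>)"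

lemma floor_mem_of_abs_le:
  fixes v :: real
  assumes "\<bar>v\<bar> \<le> real M"
  shows "\<lfloor>v\<rfloor> \<in> {- int M..int M}"
proof -
  have "of_int (- int M) \<le> v" "v \<le> of_int (int M)" using assms by simp_all
  then show ?thesis unfolding atLeastAtMost_iff by linarith
qed

text \<open>This makes the set of occupied cells finite at every level and leaves at most nine of
  them at level 0.\<close>

lemma cell_image_unit_ball:
  assumes "G \<subseteq> cball 0 1"
  shows "cell N ` G \<subseteq> {- int (2 ^ N)..int (2 ^ N)} \<times> {- int (2 ^ N)..int (2 ^ N)}"
proof -
  have "\<lfloor>2 ^ N * v\<rfloor> \<in> {- int (2 ^ N)..int (2 ^ N)}" if "\<bar>v\<bar> \<le> 1" for v :: real
  proof (rule floor_mem_of_abs_le)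
    show "\<bar>2 ^ N * v\<bar> \<le> real (2 ^ N)"
      using mult_left_mono[OF that, of "2 ^ N"] by (simp add: abs_mult)
  qed
  moreover have "\<bar>fst z\<bar> \<le> 1 \<and> \<bar>snd z\<bar> \<le> 1" if "z \<in> G" for z
  proof -
    have "z \<in> cball 0 1" using that assms by blast
    then have "norm z \<le> 1" by (simp add: dist_norm)
    then show ?thesis
      using norm_fst_le[of "fst z" "snd z"] norm_snd_le[of "snd z" "fst z"] by simp
  qed
  ultimately show ?thesis unfolding cell_def by blast
qed

lemma dist_le_of_cell_eq:
  assumes "cell N z = cell N w"
  shows "dist z w \<le> 2 / 2 ^ N"
proof -
  have *: "\<bar>u - v\<bar> \<le> 1 / 2 ^ N" if "\<lfloor>2 ^ N * u\<rfloor> = \<lfloor>2 ^ N * v\<rfloor>" for u v :: real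
  proof -
    have "\<bar>2 ^ N * u - 2 ^ N * v\<bar> < 1" using that by linarith
    then have "\<bar>2 ^ N * (u - v)\<bar> < 1" by (simp only: right_diff_distrib)
    then have "2 ^ N * \<bar>u - v\<bar> < 1" by (simp add: abs_mult)
    then show ?thesis by (simp add: pos_le_divide_eq mult.commute)
  qed
  have "dist z w \<le> dist (fst z) (fst w) + dist (snd z) (snd w)"
    unfolding dist_prod_def by (intro sqrt_sum_squares_le_sum) auto
  also have "\<dots> \<le> 1 / 2 ^ N + 1 / 2 ^ N"
    using assms by (intro add_mono) (auto simp: cell_def dist_real_def intro!: *)
  finally show ?thesis by simp
qed

text \<open>A square of level \<open>j\<close> splits into \<open>2 ^ (N - j)\<close> rows and
  columns of squares of level \<open>N\<close>, each with at most one point of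
  \<open>A\<close>.\<close>

lemma card_subcells_le:
  assumes "inj_on (cell N) A" and "j \<le> N" and "\<And>z. z \<in> A \<Longrightarrow> cell j z = v"
  shows "card A \<le> 4 ^ (N - j)"
proof -
  define m where "m = (2::int) ^ (N - j)"
  have "2 ^ N = of_int m * (2::real) ^ j"
    using assms(2) by (simp add: m_def power_add[symmetric])
  then have *: "\<lfloor>2 ^ N * x\<rfloor> \<in> {a * m..<a * m + m}" if "\<lfloor>2 ^ j * x\<rfloor> = a" for x :: real and a
  proof -
    have m: "0 < real_of_int m" by (simp add: m_def)
    have "of_int a \<le> 2 ^ j * x" "2 ^ j * x < of_int a + 1" using that by linarith+
    then have "of_int a * of_int m \<le> 2 ^ j * x * of_int m" "2 ^ j * x * of_int m < (of_int a + 1) * of_int m"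
      using m by (auto intro: mult_right_mono mult_strict_right_mono)
    then show ?thesis using \<open>2 ^ N = _\<close>
      by (auto simp: le_floor_iff floor_less_iff algebra_simps)
  qed
  have "cell N ` A \<subseteq> {fst v * m..<fst v * m + m} \<times> {snd v * m..<snd v * m + m}"
    using assms(3) * by (force simp: cell_def)
  then have "card (cell N ` A) \<le> card ({fst v * m..<fst v * m + m} \<times> {snd v * m..<snd v * m + m})"
    by (intro card_mono) auto
  also have "\<dots> = nat m * nat m" by simp
  also have "\<dots> = 4 ^ (N - j)"
    by (simp add: m_def nat_power_eq power_mult_distrib[symmetric])
  finally show ?thesis using card_image[OF assms(1)] by simp
qed

text \<open>Magnification by \<open>2 ^ j / 2\<close> shifts dyadic levels by \<open>j - 1\<close>,
  so level \<open>j + k\<close> before it corresponds to level \<open>Suc k\<close> after it, up to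
  an integer translation of the labels.\<close>

lemma cell_rescale:
  "cell (Suc k) ((1/2) *\<^sub>R (2 ^ j *\<^sub>R z - (of_int a, of_int b)))
     = (fst (cell (j + k) z) - 2 ^ k * a, snd (cell (j + k) z) - 2 ^ k * b)"
proof -
  have "2 ^ Suc k * ((1/2) * (2 ^ j * x - of_int c)) = 2 ^ (j + k) * x - of_int (2 ^ k * c)"
    for x :: real and c
    by (simp add: power_add algebra_simps)
  then show ?thesis unfolding cell_def by (simp only: fst_scaleR snd_scaleR fst_diff snd_diff
        fst_conv snd_conv real_scaleR_def floor_diff_of_int)
qed

text \<open>A ball of radius at most one side length meets only the square of its centre and the
  eight neighbours; the factor 9 in the Frostman bound counts these.\<close>

lemma cell_image_small_ball:
  assumes "2 ^ k * \<rho> \<le> 1"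
  shows "cell k ` ball z \<rho> \<subseteq> {fst (cell k z) - 1..fst (cell k z) + 1} \<times> {snd (cell k z) - 1..snd (cell k z) + 1}"
proof
  fix v assume "v \<in> cell k ` ball z \<rho>"
  then obtain w where w: "v = cell k w" "dist z w < \<rho>" by auto
  have *: "\<bar>2 ^ k * x - 2 ^ k * y\<bar> < 1" if "dist x y < \<rho>" for x y :: real
  proof -
    have "\<bar>2 ^ k * x - 2 ^ k * y\<bar> = 2 ^ k * dist x y"
      by (simp add: dist_real_def abs_mult flip: right_diff_distrib)
    also have "\<dots> < 2 ^ k * \<rho>" using that by simp
    finally show ?thesis using assms by simp
  qed
  have "\<bar>2 ^ k * fst z - 2 ^ k * fst w\<bar> < 1" "\<bar>2 ^ k * snd z - 2 ^ k * snd w\<bar> < 1"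
    using w(2) dist_fst_le[of z w] dist_snd_le[of z w] by (auto intro!: *)
  then show "v \<in> {fst (cell k z) - 1..fst (cell k z) + 1} \<times> {snd (cell k z) - 1..snd (cell k z) + 1}"
    unfolding w(1) cell_def mem_Times_iff atLeastAtMost_iff fst_conv snd_conv by linarith
qed

lemma power_two_bracket:
  fixes x :: real
  assumes "1 < x"
  obtains n where "x \<le> 2 ^ Suc n" "2 ^ n < x"
proof -
  obtain m where "x < 2 ^ m" using real_arch_pow[of 2 x] by auto
  then obtain n where "n < m" "\<forall>i\<le>n. \<not> x \<le> 2 ^ i" "x \<le> 2 ^ Suc n"
    using ex_least_nat_less[of "\<lambda>n. x \<le> 2 ^ n" m] assms by auto
  then show ?thesis using that[of n] by (auto simp: not_le)
qed

text \<open>A ball that violates the Assouad estimate with exponent \<open>t\<close> and a large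
  constant is replaced by one representative per fine dyadic cell. An evenly filled cell of this
  finite set, blown up to standard size, satisfies the discrete Frostman condition.\<close>

lemma assouad_zoom:
  fixes F :: "(real \<times> real) set"
  assumes F: "F \<noteq> {}" and t: "ereal t < assouad_dim F"
  obtains S P where "similarity S" "finite P" "P \<noteq> {}" "P \<subseteq> S ` F" "P \<subseteq> {0..1/2} \<times> {0..1/2}"
    "\<And>x \<rho>. (1/2) ^ L \<le> \<rho> \<Longrightarrow> \<rho> \<le> 1/4 \<Longrightarrow>
       real (card (P \<inter> ball x \<rho>)) \<le> 9 * (4 * \<rho>) powr t * real (card P)"
\<comment> \<open>For negative \<open>t\<close> the factor \<open>(4 * \<rho>) powr t\<close> is at
  least 1, so one point suffices. This covers Assouad dimension 0, below which there is no
  nonnegative \<open>t\<close>.\<close>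
proof (cases "t < 0")
  case True
  obtain p where p: "p \<in> F" using F by blast
  show ?thesis
  proof (rule that[of "\<lambda>z. z - p" "{0}"])
    show "similarity (\<lambda>z. z - p)"
      unfolding similarity_def by (intro exI[of _ 1]) (simp add: dist_norm)
    show "{0} \<subseteq> (\<lambda>z. z - p) ` F" using p by force
    show "{0} \<subseteq> {0..1/2::real} \<times> {0..1/2::real}" by (simp add: zero_prod_def)
    fix x :: "real \<times> real" and \<rho> :: real assume \<rho>: "(1/2) ^ L \<le> \<rho>" "\<rho> \<le> 1/4"
    have "0 < \<rho>" by (rule less_le_trans[OF _ \<rho>(1)]) simp
    then have "1 \<le> (4 * \<rho>) powr t"
      using True \<rho>(2) powr_mono2'[of t "4 * \<rho>" 1] by simp
    moreover have "card ({0} \<inter> ball x \<rho>) \<le> card {0 :: real \<times> real}" by (intro card_mono) auto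
    ultimately show "real (card ({0} \<inter> ball x \<rho>)) \<le> 9 * (4 * \<rho>) powr t * real (card {0 :: real \<times> real})"
      by simp
  qed auto
next
  case False
  then have "0 \<le> t" by simp
  \<comment> \<open>The factor 9 pays for the cells of level 0, \<open>4 ^ L\<close> for the points
    in a cell fewer than \<open>L\<close> levels above the finest, and \<open>4 powr t\<close> for
    rounding \<open>R / r\<close> to the power \<open>2 ^ N\<close>.\<close>
  define M :: real where "M = 9 * 4 ^ L * 4 powr t"
  have "0 < M" by (simp add: M_def)
  have "\<not> (\<forall>R>0. \<forall>r\<in>{0<..<R}. \<forall>x\<in>F. real (covering_number r (cball x R \<inter> F)) \<le> M * (R / r) powr t)"
  proof
    assume "\<forall>R>0. \<forall>r\<in>{0<..<R}. \<forall>x\<in>F. real (covering_number r (cball x R \<inter> F)) \<le> M * (R / r) powr t"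
    then have "assouad_dim F \<le> ereal t"
      unfolding assouad_dim_def using \<open>0 \<le> t\<close> \<open>0 < M\<close> by (intro Inf_lower) blast
    with t show False by simp
  qed
  then obtain R r x where R: "0 < R" "0 < r" "r < R"
    and large: "M * (R / r) powr t < real (covering_number r (cball x R \<inter> F))"
    by (auto simp: not_le)
  define G where "G = cball x R \<inter> F"
  define h where "h z = (1 / R) *\<^sub>R (z - x)" for z
  have dist_h: "dist (h z) (h w) = dist z w / R" for z w
    using R by (simp add: h_def dist_norm flip: scaleR_diff_right)
  have hG: "h ` G \<subseteq> cball 0 1"
  proof -
    have "h x = 0" by (simp add: h_def)
    then show ?thesis using R dist_h[of x] by (auto simp: G_def)
  qed
  define c where "c k z = cell k (h z)" for k z
  \<comment> \<open>Cells of level \<open>N\<close> have diameter at most \<open>2 / 2 ^ N\<close>,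
    hence at most \<open>r / R\<close>. One point per cell therefore gives the centres of an
    \<open>r\<close>-cover in the original scale.\<close>
  obtain N where N: "2 * R / r \<le> 2 ^ N" "2 ^ N < 4 * R / r"
  proof -
    have "1 < 2 * R / r" using R by (simp add: field_simps)
    then obtain n where "2 * R / r \<le> 2 ^ Suc n" "2 ^ n < 2 * R / r"
      by (rule power_two_bracket)
    then show ?thesis using that[of "Suc n"] by simp
  qed
  obtain P where P: "P \<subseteq> G" "inj_on (c N) P" "c N ` P = c N ` G"
    using subset_image_inj[of "c N ` G" "c N" G] by auto
  have fin: "finite (c k ` G)" for k
    using finite_subset[OF cell_image_unit_ball[OF hG, of k]] by (simp add: c_def image_image)
  then have "finite P" using P(2,3) finite_imageD by metis
  have "covering_number r G \<le> card P"
  proof (rule covering_number_le[OF \<open>finite P\<close>], rule subsetI)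
    fix z assume "z \<in> G"
    then obtain p where p: "p \<in> P" "c N z = c N p" using P(3) by (metis imageE imageI)
    then have "dist (h p) (h z) \<le> 2 / 2 ^ N" by (intro dist_le_of_cell_eq) (simp add: c_def)
    also have "\<dots> \<le> r / R" using N(1) R by (simp add: field_simps)
    finally have "dist p z \<le> r" using R by (simp add: dist_h divide_le_cancel)
    with p(1) show "z \<in> (\<Union>p\<in>P. cball p r)" by auto
  qed
  with large have large': "M * (R / r) powr t < real (card P)" by (simp add: G_def)
  moreover have "0 \<le> M * (R / r) powr t" using \<open>0 < M\<close> by simp
  ultimately have "P \<noteq> {}" by auto
  have "card (c 0 ` P) \<le> card ({- 1..1::int} \<times> {- 1..1::int})"
    using cell_image_unit_ball[OF hG, of 0] P(1) by (intro card_mono) (auto simp: c_def)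
  then have "card (c 0 ` P) \<le> 9" by simp
  \<comment> \<open>By the pigeonhole principle the fullest cell of level 0 holds at least a ninth
    of \<open>P\<close>.\<close>
  obtain p0 where p0: "p0 \<in> P" "card P \<le> 9 * card {q \<in> P. c 0 q = c 0 p0}"
  proof -
    define f where "f p = card {q \<in> P. c 0 q = c 0 p}" for p
    have "Max (f ` P) \<in> f ` P" using \<open>finite P\<close> \<open>P \<noteq> {}\<close> by (intro Max_in) auto
    then obtain p0 where "p0 \<in> P" "Max (f ` P) = f p0" by blast
    then have max: "f p \<le> f p0" if "p \<in> P" for p
      using Max_ge[of "f ` P" "f p"] \<open>finite P\<close> that by auto
    have "P = (\<Union>v\<in>c 0 ` P. {q \<in> P. c 0 q = v})" by auto
    then have "card P = card (\<Union>v\<in>c 0 ` P. {q \<in> P. c 0 q = v})" by simp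
    also have "\<dots> \<le> (\<Sum>v\<in>c 0 ` P. card {q \<in> P. c 0 q = v})"
      using \<open>finite P\<close> by (intro card_UN_le) simp
    also have "\<dots> \<le> card (c 0 ` P) * card {q \<in> P. c 0 q = c 0 p0}"
    proof -
      have "card {q \<in> P. c 0 q = v} \<le> f p0" if "v \<in> c 0 ` P" for v
        using that max unfolding f_def by blast
      then show ?thesis
        using sum_bounded_above[of "c 0 ` P" "\<lambda>v. card {q \<in> P. c 0 q = v}" "f p0"]
        by (simp add: f_def)
    qed
    also have "\<dots> \<le> 9 * card {q \<in> P. c 0 q = c 0 p0}"
      using \<open>card (c 0 ` P) \<le> 9\<close> by (rule mult_le_mono1)
    finally show ?thesis using that \<open>p0 \<in> P\<close> by blast
  qed
  define D where "D j p = {q \<in> P. c j q = c j p}" for j p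
  show ?thesis
  proof (rule exists_equidistributed_cell[where c = c and L = L and t = t and N = N,
        OF \<open>finite P\<close> p0(1), folded D_def])
    \<comment> \<open>The outcome \<open>deep\<close> is impossible: such a cell holds at most
      \<open>4 ^ L\<close> points, and \<open>P\<close> would be smaller than \<open>large'\<close>
      says.\<close>
    fix j p
    assume *: "p \<in> P" "j \<le> N" "N < j + L"
      and ge: "2 powr (- real j * t) * real (card (D 0 p0)) \<le> real (card (D j p))"
    have "card (h ` D j p) \<le> 4 ^ (N - j)"
      using *(2)
    proof (rule card_subcells_le[rotated])
      show "inj_on (cell N) (h ` D j p)"
        using inj_on_subset[OF P(2), of "D j p"]
        by (auto simp: D_def inj_on_def c_def)
      show "cell j z = c j p" if "z \<in> h ` D j p" for z
        using that by (auto simp: D_def c_def)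
    qed
    moreover have "inj_on h (D j p)" using R by (auto simp: inj_on_def h_def)
    ultimately have "card (D j p) \<le> 4 ^ (N - j)" by (simp add: card_image)
    also have "\<dots> \<le> (4::nat) ^ L" using *(3) by (intro power_increasing) auto
    finally have le: "real (card (D j p)) \<le> 4 ^ L" by (metis of_nat_le_iff of_nat_numeral of_nat_power)
    have "real (card (D 0 p0)) = 2 powr (real j * t) * (2 powr (- real j * t) * real (card (D 0 p0)))"
      by (simp add: powr_minus)
    also have "\<dots> \<le> 2 powr (real j * t) * 4 ^ L"
      using order_trans[OF ge le] by (rule mult_left_mono) simp
    also have "\<dots> \<le> (4 powr t * (R / r) powr t) * 4 ^ L"
    proof (rule mult_right_mono)
      have "2 powr (real j * t) = (2 ^ j) powr t"
        by (simp add: powr_powr flip: powr_realpow)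
      also have "\<dots> \<le> (4 * R / r) powr t"
      proof (rule powr_mono2[OF \<open>0 \<le> t\<close>])
        have "(2::real) ^ j \<le> 2 ^ N" using *(2) by (intro power_increasing) auto
        with N(2) show "2 ^ j \<le> 4 * R / r" by linarith
      qed simp
      also have "(4 * R / r) powr t = 4 powr t * (R / r) powr t"
        using powr_mult[of 4 "R / r" t] by (simp only: times_divide_eq_right)
      finally show "2 powr (real j * t) \<le> 4 powr t * (R / r) powr t" .
    qed simp
    finally have "9 * real (card (D 0 p0)) \<le> M * (R / r) powr t" by (simp add: M_def mult_ac)
    moreover have "real (card P) \<le> 9 * real (card (D 0 p0))" using p0(2) by (simp add: D_def)
    ultimately have "real (card P) \<le> M * (R / r) powr t" by simp
    with large' show ?thesis by simp
  next
    fix j p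
    assume p: "p \<in> P"
      and good: "\<And>k q. k \<le> L \<Longrightarrow> q \<in> D j p \<Longrightarrow>
        real (card (D (j + k) q)) \<le> 2 powr (- real k * t) * real (card (D j p))"
    obtain a b where ab: "c j p = (a, b)" by fastforce
    \<comment> \<open>The cell \<open>(a, b)\<close> becomes a unit square at the origin; the factor
      \<open>1/2\<close> shrinks it so that it fits into both reference sets, the ball and the
      cube.\<close>
    define S where "S z = (1/2) *\<^sub>R (2 ^ j *\<^sub>R h z - (of_int a, of_int b))" for z
    have dist_S: "dist (S z) (S w) = (2 ^ j / (2 * R)) * dist z w" for z w
    proof -
      have "dist (S z) (S w) = (1/2) * (2 ^ j * dist (h z) (h w))"
        by (simp add: S_def dist_norm flip: scaleR_diff_right)
      then show ?thesis by (simp add: dist_h)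
    qed
    have "inj S"
    proof (rule injI)
      fix z w assume "S z = S w"
      then show "z = w" using dist_S[of z w] R by simp
    qed
    have "finite (D j p)" using \<open>finite P\<close> by (simp add: D_def)
    have card_S: "card (S ` A) = card A" for A
      using inj_on_subset[OF \<open>inj S\<close> subset_UNIV] by (rule card_image)
    show ?thesis
    proof (rule that[of S "S ` D j p"])
      show "similarity S"
        unfolding similarity_def
      proof (intro exI conjI allI)
        show "0 < 2 ^ j / (2 * R)" using R by simp
      qed (rule dist_S)
      show "finite (S ` D j p)" using \<open>finite (D j p)\<close> by simp
      show "S ` D j p \<noteq> {}" using p unfolding D_def by blast
      show "S ` D j p \<subseteq> S ` F" using P(1) unfolding D_def G_def by blast
      show "S ` D j p \<subseteq> {0..1/2} \<times> {0..1/2}"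
      proof (rule image_subsetI)
        fix q assume "q \<in> D j p"
        then have "cell j (h q) = (a, b)" using ab by (simp add: D_def c_def)
        moreover have "(1/2) * (2 ^ j * u - of_int m) \<in> {0..1/2}" if "\<lfloor>2 ^ j * u\<rfloor> = m" for u :: real and m
        proof -
          have "of_int m \<le> 2 ^ j * u" "2 ^ j * u \<le> of_int m + 1" using that by linarith+
          then show ?thesis by simp
        qed
        ultimately show "S q \<in> {0..1/2} \<times> {0..1/2}"
          unfolding cell_def S_def mem_Times_iff Pair_inject fst_scaleR snd_scaleR fst_diff snd_diff
            fst_conv snd_conv real_scaleR_def by blast
      qed
      fix y :: "real \<times> real" and \<rho> :: real
      assume \<rho>: "(1/2) ^ L \<le> \<rho>" "\<rho> \<le> 1/4"
      have "0 < \<rho>" by (rule less_le_trans[OF _ \<rho>(1)]) simp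
      \<comment> \<open>The first inequality lets the ball meet only nine cells of level
        \<open>Suc k\<close>; the second gives \<open>1 / 2 ^ k \<le> 4 * \<rho>\<close>.\<close>
      obtain k where k: "2 ^ Suc k * \<rho> \<le> 1" "1 \<le> 2 ^ Suc (Suc k) * \<rho>"
      proof -
        obtain n where n: "1 / \<rho> \<le> 2 ^ Suc n" "2 ^ n < 1 / \<rho>"
          using power_two_bracket[of "1 / \<rho>"] \<open>0 < \<rho>\<close> \<rho>(2) by auto
        have "n \<noteq> 0"
        proof
          assume "n = 0"
          then show False using n(1) \<open>0 < \<rho>\<close> \<rho>(2) by (simp add: pos_divide_le_eq)
        qed
        then obtain k where "n = Suc k" using not0_implies_Suc by blast
        then show ?thesis using that[of k] n \<open>0 < \<rho>\<close>
          by (simp add: pos_divide_le_eq pos_less_divide_eq mult.commute)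
      qed
      have "k \<le> L"
      proof -
        have "(2::real) ^ Suc k * (1/2) ^ L \<le> 1"
          by (rule order_trans[OF mult_left_mono[OF \<rho>(1)] k(1)]) simp
        then have "(2::real) ^ Suc k \<le> 2 ^ L"
          by (simp only: power_one_over mult_1_right times_divide_eq_right pos_divide_le_eq zero_less_power
              zero_less_numeral mult_1_left)
        then have "Suc k \<le> L" by (rule power_le_imp_le_exp[rotated]) simp
        then show ?thesis by simp
      qed
      define V where "V = {fst (cell (Suc k) y) - 1..fst (cell (Suc k) y) + 1} \<times>
          {snd (cell (Suc k) y) - 1..snd (cell (Suc k) y) + 1}"
      define B where "B v = {q \<in> D j p. cell (Suc k) (S q) = v}" for v
      have B: "real (card (B v)) \<le> (4 * \<rho>) powr t * real (card (D j p))" for v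
      proof (cases "B v = {}")
        case False
        then obtain q0 where q0: "q0 \<in> B v" by blast
        \<comment> \<open>Undoing the magnification places all of \<open>B v\<close> in a single
          cell of level \<open>j + k\<close>, to which \<open>good\<close> applies.\<close>
        have "B v \<subseteq> D (j + k) q0"
        proof
          fix q assume "q \<in> B v"
          then have "cell (Suc k) (S q) = cell (Suc k) (S q0)" "q \<in> P"
            using q0 by (simp_all add: B_def D_def)
          then show "q \<in> D (j + k) q0"
            unfolding S_def cell_rescale by (simp add: D_def c_def prod_eq_iff)
        qed
        then have "real (card (B v)) \<le> real (card (D (j + k) q0))"
          using \<open>finite P\<close> by (intro of_nat_mono card_mono) (auto simp: D_def)
        also have "\<dots> \<le> 2 powr (- real k * t) * real (card (D j p))"
          using q0 by (intro good \<open>k \<le> L\<close>) (simp add: B_def)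
        also have "\<dots> \<le> (4 * \<rho>) powr t * real (card (D j p))"
        proof (rule mult_right_mono)
          have "2 powr - real k = 1 / 2 ^ k" by (simp add: powr_minus_divide powr_realpow)
          then have "2 powr (- real k * t) = (1 / 2 ^ k) powr t"
            by (metis powr_powr)
          also have "\<dots> \<le> (4 * \<rho>) powr t"
            using k(2) \<open>0 < \<rho>\<close> by (intro powr_mono2[OF \<open>0 \<le> t\<close>]) (auto simp: field_simps)
          finally show "2 powr (- real k * t) \<le> (4 * \<rho>) powr t" .
        qed simp
        finally show ?thesis .
      qed simp
      have "S ` D j p \<inter> ball y \<rho> \<subseteq> S ` (\<Union>v\<in>V. B v)"
        using cell_image_small_ball[OF k(1), of y] by (force simp: B_def V_def)
      then have "card (S ` D j p \<inter> ball y \<rho>) \<le> card (S ` (\<Union>v\<in>V. B v))"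
        using \<open>finite (D j p)\<close> by (intro card_mono) (auto simp: V_def B_def)
      also have "\<dots> \<le> (\<Sum>v\<in>V. card (B v))"
        unfolding card_S by (intro card_UN_le) (simp add: V_def)
      finally have "real (card (S ` D j p \<inter> ball y \<rho>)) \<le> (\<Sum>v\<in>V. real (card (B v)))"
        by (metis of_nat_le_iff of_nat_sum)
      also have "\<dots> \<le> real (card V) * ((4 * \<rho>) powr t * real (card (D j p)))"
        using B by (intro sum_bounded_above) auto
      also have "card V = 9" by (simp add: V_def)
      finally show "real (card (S ` D j p \<inter> ball y \<rho>)) \<le> 9 * (4 * \<rho>) powr t * real (card (S ` D j p))"
        by (simp add: card_S)
    qed
  qed
qed

text \<open>Zooms are taken with exponents tending to the Assouad dimension and with cut-offs
  tending to 0. A Hausdorff limit of the zoomed sets inherits the lower bound for every smaller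
  exponent; the upper bound holds for all weak tangents.\<close>

theorem exists_weak_tangent_of_full_dimension:
  fixes F X :: "(real \<times> real) set"
  assumes F: "compact F" "F \<noteq> {}" and X: "compact X" "{0..1/2} \<times> {0..1/2} \<subseteq> X"
  obtains E where "weak_tangent X E F" "hausdorff_dim E = assouad_dim F"
proof -
  have "0 \<le> assouad_dim F" unfolding assouad_dim_def by (intro Inf_greatest) auto
  then have "-1 < assouad_dim F" by (rule less_le_trans[rotated]) simp
  then obtain v where v: "\<And>n::nat. v n < assouad_dim F" "v \<longlonglongrightarrow> assouad_dim F"
    using approx_from_below_dense_linorder[OF \<open>-1 < assouad_dim F\<close>] by blast
  \<comment> \<open>The maximum with -1 excludes the value \<open>-\<infinity>\<close>, so the
    exponents are real; -1 also leaves room below a dimension equal to 0.\<close>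
  define w where "w n = max (-1) (v n)" for n
  have "w \<longlonglongrightarrow> max (-1) (assouad_dim F)"
    unfolding w_def[abs_def] by (intro tendsto_max tendsto_const v(2))
  then have w_lim: "w \<longlonglongrightarrow> assouad_dim F" using max_absorb2[OF less_imp_le[OF \<open>-1 < assouad_dim F\<close>]] by simp
  have w: "-1 \<le> w n" "w n < assouad_dim F" for n
    using v(1)[of n] \<open>-1 < assouad_dim F\<close> by (auto simp: w_def)
  define t where "t n = real_of_ereal (w n)" for n
  have "\<bar>w n\<bar> \<noteq> \<infinity>" for n
  proof -
    have "w n \<noteq> -\<infinity>" using w(1)[of n] by auto
    moreover have "w n \<noteq> \<infinity>" using w(2)[of n] by auto
    ultimately show ?thesis by auto
  qed
  then have t: "ereal (t n) = w n" for n by (simp add: t_def ereal_real)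
  have "\<exists>S P. similarity S \<and> finite P \<and> P \<noteq> {} \<and> P \<subseteq> S ` F \<and> P \<subseteq> {0..1/2} \<times> {0..1/2} \<and>
      (\<forall>x \<rho>. (1/2) ^ Suc n \<le> \<rho> \<longrightarrow> \<rho> \<le> 1/4 \<longrightarrow>
         real (card (P \<inter> ball x \<rho>)) \<le> 9 * (4 * \<rho>) powr t n * real (card P))" for n
    using assouad_zoom[OF F(2), of "t n" "Suc n"] w(2)[of n] unfolding t by metis
  then obtain S P where S: "\<And>n. similarity (S n)"
    and P: "\<And>n. finite (P n)" "\<And>n. P n \<noteq> {}" "\<And>n. P n \<subseteq> S n ` F" "\<And>n. P n \<subseteq> {0..1/2} \<times> {0..1/2}"
    and Frostman: "\<And>n x \<rho>. (1/2) ^ Suc n \<le> \<rho> \<Longrightarrow> \<rho> \<le> 1/4 \<Longrightarrow>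
         real (card (P n \<inter> ball x \<rho>)) \<le> 9 * (4 * \<rho>) powr t n * real (card (P n))"
    by metis
  define K where "K n = S n ` F \<inter> X" for n
  have PK: "P n \<subseteq> K n" for n using P(3,4)[of n] X(2) by (auto simp: K_def)
  have "continuous_on F (S n)" for n
  proof -
    obtain c where "0 < c" "\<And>x y. dist (S n x) (S n y) = c * dist x y"
      using S[of n] unfolding similarity_def by blast
    then have "c-lipschitz_on F (S n)" by (intro lipschitz_onI) auto
    then show ?thesis by (rule lipschitz_on_continuous_on)
  qed
  then have K: "compact (K n)" "K n \<noteq> {}" "K n \<subseteq> X" for n
    using PK[of n] P(2)[of n] F(1) X(1) by (auto simp: K_def intro!: compact_Int compact_continuous_image)
  obtain E r where E: "compact E" "E \<noteq> {}" and r: "strict_mono (r :: nat \<Rightarrow> nat)"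
    and lim: "(\<lambda>n. hausdorff_dist E (K (r n))) \<longlonglongrightarrow> 0"
    by (rule Blaschke_selection[OF X(1) K])
  have tangent: "weak_tangent X E F"
    unfolding weak_tangent_def using E(1) F(1) S lim unfolding K_def
    by (intro conjI exI[of _ "\<lambda>n. S (r n)"]) auto
  have "assouad_dim F \<le> hausdorff_dim E"
  proof (rule hausdorff_dim_ge_of_discrete_Frostman[OF E(1), where P = "\<lambda>n. P (r n)" and d = "1/4" and A = 9, OF PK P(1,2) lim])
    fix u :: real assume u: "0 \<le> u" "ereal u < assouad_dim F"
    have "eventually (\<lambda>n. ereal u < w (r n)) sequentially"
      using LIMSEQ_subseq_LIMSEQ[OF w_lim r] u(2)
      by (intro order_tendstoD) (auto simp: o_def)
    then show "eventually (\<lambda>n. \<forall>x \<rho>. inverse (real (Suc n)) \<le> \<rho> \<and> \<rho> \<le> 1/4 \<longrightarrow>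
        real (card (P (r n) \<inter> ball x \<rho>)) \<le> 9 * (\<rho> / (1/4)) powr u * real (card (P (r n)))) sequentially"
    proof eventually_elim
      case (elim n)
      have ut: "u \<le> t (r n)" using elim by (simp flip: t)
      show ?case
      proof (intro allI impI)
        fix x \<rho> assume \<rho>: "inverse (real (Suc n)) \<le> \<rho> \<and> \<rho> \<le> 1/4"
        have "0 < \<rho>" by (rule less_le_trans[OF _ conjunct1[OF \<rho>]]) simp
        \<comment> \<open>Along the subsequence the zoom is controlled down to
          \<open>(1/2) ^ Suc (r n)\<close>, which lies below the cut-off because
          \<open>n \<le> r n\<close>.\<close>
        have "Suc n \<le> 2 ^ Suc (r n)"
          using strict_mono_imp_increasing[OF r, of n] less_exp[of "Suc (r n)"] by linarith
        then have "real (Suc n) \<le> 2 ^ Suc (r n)" by (metis of_nat_le_iff of_nat_numeral of_nat_power)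
        then have "inverse (2 ^ Suc (r n)) \<le> inverse (real (Suc n))"
          by (intro le_imp_inverse_le) simp_all
        then have "(1/2) ^ Suc (r n) \<le> \<rho>" using \<rho> by (simp add: power_one_over inverse_eq_divide)
        then have "real (card (P (r n) \<inter> ball x \<rho>)) \<le> 9 * (4 * \<rho>) powr t (r n) * real (card (P (r n)))"
          using Frostman \<rho> by blast
        \<comment> \<open>The base \<open>4 * \<rho>\<close> is at most 1, so lowering the exponent
          raises the bound.\<close>
        also have "\<dots> \<le> 9 * (4 * \<rho>) powr u * real (card (P (r n)))"
          using \<rho> \<open>0 < \<rho>\<close> ut by (intro mult_right_mono mult_left_mono powr_mono') auto
        finally show "real (card (P (r n) \<inter> ball x \<rho>)) \<le> 9 * (\<rho> / (1/4)) powr u * real (card (P (r n)))"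
          by (simp add: mult.commute)
      qed
    qed
  qed auto
  moreover have "hausdorff_dim E \<le> assouad_dim F"
    using tangent compact_imp_bounded[OF X(1)] by (rule hausdorff_dim_weak_tangent_le)
  ultimately show ?thesis using that tangent by (metis antisym)
qed

section \<open>Graphs of Takagi functions\<close>

text \<open>The tent map is the distance to the nearest integer; together with attainment at some
  integer this gives the Lipschitz constant 1.\<close>

lemma tent_le_abs_diff: "tent x \<le> \<bar>x - of_int n\<bar>"
proof -
  have "n \<le> \<lfloor>x\<rfloor> \<or> \<lfloor>x\<rfloor> + 1 \<le> n" by linarith
  then have "real_of_int n \<le> \<lfloor>x\<rfloor> \<or> \<lfloor>x\<rfloor> + 1 \<le> real_of_int n" by linarith
  moreover have "\<lfloor>x\<rfloor> \<le> x" "x < \<lfloor>x\<rfloor> + 1" by linarith+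
  ultimately show ?thesis unfolding tent_def frac_def by (auto simp: abs_if)
qed

lemma tent_eq_abs_diff: "\<exists>n. tent x = \<bar>x - of_int n\<bar>"
proof (cases "frac x \<le> 1/2")
  case True
  then show ?thesis
    by (intro exI[of _ "\<lfloor>x\<rfloor>"]) (simp add: tent_def frac_def)
next
  case False
  moreover have "frac x < 1" by (rule frac_lt_1)
  ultimately show ?thesis
    by (intro exI[of _ "\<lfloor>x\<rfloor> + 1"]) (simp add: tent_def frac_def)
qed

lemma tent_nonneg: "0 \<le> tent x"
  using frac_ge_0[of x] frac_lt_1[of x] by (simp add: tent_def)

lemma tent_le_half: "tent x \<le> 1/2"
  by (simp add: tent_def)

lemma tent_lipschitz: "\<bar>tent x - tent y\<bar> \<le> \<bar>x - y\<bar>"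
proof -
  have "tent x \<le> tent y + \<bar>x - y\<bar>" for x y
  proof -
    obtain n where "tent y = \<bar>y - of_int n\<bar>" using tent_eq_abs_diff by blast
    then show ?thesis using tent_le_abs_diff[of x n] by linarith
  qed
  from this[of x y] this[of y x] show ?thesis by linarith
qed

lemma tent_add_int: "tent (x + of_int n) = tent x"
  by (simp add: tent_def frac_def)

section \<open>Regularity and box dimension of the graph for \<open>0 < a < 1\<close>\<close>

context
  fixes a b :: real
  assumes a: "0 < a" "a < 1"
begin

lemma takagi_term_bounds: "0 \<le> a ^ n * tent (b ^ n * x)" "a ^ n * tent (b ^ n * x) \<le> a ^ n"
proof -
  show "0 \<le> a ^ n * tent (b ^ n * x)" using a tent_nonneg by simp
  show "a ^ n * tent (b ^ n * x) \<le> a ^ n"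
    using a tent_le_half[of "b ^ n * x"] mult_left_le[of "tent (b ^ n * x)" "a ^ n"] by simp
qed

lemma takagi_summable: "summable (\<lambda>n. a ^ n * tent (b ^ n * x))"
proof (rule summable_comparison_test)
  show "\<exists>N. \<forall>n\<ge>N. norm (a ^ n * tent (b ^ n * x)) \<le> a ^ n"
    using takagi_term_bounds by auto
qed (use a in auto)

lemma takagi_nonneg: "0 \<le> takagi a b x"
  unfolding takagi_def using takagi_summable takagi_term_bounds by (intro suminf_nonneg) auto

text \<open>Self-affinity: the tail of the series is the function itself, with its argument
  multiplied by \<open>b ^ m\<close> and its values by \<open>a ^ m\<close>.\<close>

lemma takagi_split: "takagi a b x = (\<Sum>n<m. a ^ n * tent (b ^ n * x)) + a ^ m * takagi a b (b ^ m * x)"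
proof -
  have "takagi a b x = (\<Sum>n. a ^ (n + m) * tent (b ^ (n + m) * x)) + (\<Sum>n<m. a ^ n * tent (b ^ n * x))"
    unfolding takagi_def by (rule suminf_split_initial_segment[OF takagi_summable])
  also have "(\<Sum>n. a ^ (n + m) * tent (b ^ (n + m) * x)) = (\<Sum>n. a ^ m * (a ^ n * tent (b ^ n * (b ^ m * x))))"
    by (simp add: power_add mult_ac)
  also have "\<dots> = a ^ m * takagi a b (b ^ m * x)"
    unfolding takagi_def by (rule suminf_mult[OF takagi_summable])
  finally show ?thesis by simp
qed

lemma takagi_le: "takagi a b x \<le> 1 / (1 - a)"
proof -
  have "takagi a b x \<le> (\<Sum>n. a ^ n)"
    unfolding takagi_def using takagi_term_bounds takagi_summable a by (intro suminf_le) auto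
  then show ?thesis using a by (simp add: suminf_geometric)
qed

lemma continuous_on_takagi: "continuous_on A (takagi a b)"
proof -
  have "uniform_limit A (\<lambda>n x. \<Sum>i<n. a ^ i * tent (b ^ i * x)) (\<lambda>x. \<Sum>i. a ^ i * tent (b ^ i * x)) sequentially"
  proof (rule Weierstrass_m_test)
    show "norm (a ^ n * tent (b ^ n * x)) \<le> a ^ n" for n x
      using takagi_term_bounds[of n x] by simp
  qed (use a in auto)
  moreover have "continuous_on A (\<lambda>x. \<Sum>i<n. a ^ i * tent (b ^ i * x))" for n
  proof -
    have "1-lipschitz_on UNIV tent"
      using tent_lipschitz by (intro lipschitz_onI) (auto simp: dist_real_def)
    then have "continuous_on UNIV tent" by (rule lipschitz_on_continuous_on)
    then have "continuous_on A (\<lambda>x. tent (b ^ i * x))" for i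
      by (rule continuous_on_compose2) (auto intro!: continuous_intros)
    then show ?thesis by (intro continuous_intros) auto
  qed
  ultimately show ?thesis
    unfolding takagi_def[abs_def] by (intro uniform_limit_theorem[rotated]) auto
qed

lemma compact_graph_takagi: "compact (graph_unit (takagi a b))"
proof -
  have "graph_unit (takagi a b) = (\<lambda>x. (x, takagi a b x)) ` {0..1}"
    by (auto simp: graph_unit_def)
  moreover have "continuous_on {0..1} (\<lambda>x. (x, takagi a b x))"
    by (intro continuous_intros continuous_on_takagi)
  ultimately show ?thesis by (simp add: compact_continuous_image)
qed

text \<open>The first \<open>m\<close> terms are Lipschitz with constants growing like
  \<open>(a * b) ^ n\<close>, so their sum is comparable to the last one; the tail is bounded by its
  size. The two summands of the constant belong to these two parts.\<close>

lemma takagi_oscillation: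
  assumes ab: "1 < a * b" and xy: "\<bar>x - y\<bar> \<le> 1 / b ^ m"
  shows "\<bar>takagi a b x - takagi a b y\<bar> \<le> (1 / (a * b - 1) + 1 / (1 - a)) * a ^ m"
proof -
  have "0 < b" using ab a by (metis less_trans zero_less_mult_pos zero_less_one)
  have "\<bar>a ^ n * tent (b ^ n * x) - a ^ n * tent (b ^ n * y)\<bar> \<le> (a * b) ^ n / b ^ m" for n
  proof -
    have "\<bar>a ^ n * tent (b ^ n * x) - a ^ n * tent (b ^ n * y)\<bar> = a ^ n * \<bar>tent (b ^ n * x) - tent (b ^ n * y)\<bar>"
      using a by (simp add: abs_mult flip: right_diff_distrib)
    also have "\<dots> \<le> a ^ n * \<bar>b ^ n * x - b ^ n * y\<bar>"
      using a tent_lipschitz by (intro mult_left_mono) auto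
    also have "\<bar>b ^ n * x - b ^ n * y\<bar> = b ^ n * \<bar>x - y\<bar>"
      using \<open>0 < b\<close> by (simp add: abs_mult flip: right_diff_distrib)
    also have "a ^ n * (b ^ n * \<bar>x - y\<bar>) \<le> a ^ n * (b ^ n * (1 / b ^ m))"
      using a \<open>0 < b\<close> xy by (intro mult_left_mono) auto
    finally show ?thesis by (simp add: power_mult_distrib)
  qed
  then have "\<bar>(\<Sum>n<m. a ^ n * tent (b ^ n * x)) - (\<Sum>n<m. a ^ n * tent (b ^ n * y))\<bar> \<le> (\<Sum>n<m. (a * b) ^ n / b ^ m)"
    unfolding sum_subtractf[symmetric] by (intro order_trans[OF sum_abs] sum_mono)
  also have "\<dots> = (((a * b) ^ m - 1) / (a * b - 1)) / b ^ m"
    using ab by (simp add: geometric_sum flip: sum_divide_distrib)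
  also have "\<dots> \<le> ((a * b) ^ m / (a * b - 1)) / b ^ m"
    using ab \<open>0 < b\<close> by (intro divide_right_mono) auto
  also have "\<dots> = 1 / (a * b - 1) * a ^ m"
    using \<open>0 < b\<close> by (simp add: power_mult_distrib)
  finally have 1: "\<bar>(\<Sum>n<m. a ^ n * tent (b ^ n * x)) - (\<Sum>n<m. a ^ n * tent (b ^ n * y))\<bar> \<le> 1 / (a * b - 1) * a ^ m" .
  have "\<bar>takagi a b (b ^ m * x) - takagi a b (b ^ m * y)\<bar> \<le> 1 / (1 - a)"
    using takagi_le[of "b ^ m * x"] takagi_le[of "b ^ m * y"] takagi_nonneg[of "b ^ m * x"] takagi_nonneg[of "b ^ m * y"]
    by linarith
  then have "a ^ m * \<bar>takagi a b (b ^ m * x) - takagi a b (b ^ m * y)\<bar> \<le> a ^ m * (1 / (1 - a))"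
    using a by (intro mult_left_mono) auto
  then have 2: "\<bar>a ^ m * takagi a b (b ^ m * x) - a ^ m * takagi a b (b ^ m * y)\<bar> \<le> 1 / (1 - a) * a ^ m"
    using a by (simp add: abs_mult mult.commute flip: right_diff_distrib)
  show ?thesis
    unfolding takagi_split[of x m] takagi_split[of y m] distrib_right using 1 2 by linarith
qed

text \<open>There are about \<open>b ^ m\<close> columns of width \<open>1 / b ^ m\<close>. Over
  each the graph oscillates by order \<open>a ^ m\<close>, which takes order
  \<open>(a * b) ^ m\<close> balls.\<close>

lemma covering_number_graph_takagi:
  assumes ab: "1 < a * b" and b: "b \<in> \<nat>"
  obtains K where "0 < K" "\<And>m. real (covering_number (2 / b ^ m) (graph_unit (takagi a b))) \<le> K * (a * b * b) ^ m"
proof -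
  obtain B where B: "b = real B" using b unfolding Nats_def by auto
  have "0 < b" using ab a by (metis less_trans zero_less_mult_pos zero_less_one)
  then have "1 < b" using ab a mult_strict_right_mono[of a 1 b] by linarith
  define H where "H = 1 / (a * b - 1) + 1 / (1 - a)"
  have "0 < H" unfolding H_def using ab a by (intro add_pos_pos) auto
  have "real (covering_number (2 / b ^ m) (graph_unit (takagi a b))) \<le> 2 * (2 * H + 3) * (a * b * b) ^ m" for m
  proof -
    define h where "h = 1 / b ^ m"
    have "0 < h" using \<open>0 < b\<close> by (simp add: h_def)
    define Q where "Q = \<lceil>H * (a * b) ^ m\<rceil>"
    have "0 \<le> H * (a * b) ^ m" using \<open>0 < H\<close> ab by simp
    then have "0 \<le> Q" unfolding Q_def by linarith
    \<comment> \<open>Each column carries a ladder of step \<open>h\<close> based at the graph point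
      over its left end. Both coordinates are off by at most \<open>h\<close>, hence the radius
      \<open>2 * h\<close>.\<close>
    define C where "C = (\<lambda>(i, q). (real i * h, takagi a b (real i * h) + of_int q * h)) ` ({0..B ^ m} \<times> {- Q..Q})"
    have "graph_unit (takagi a b) \<subseteq> (\<Union>c\<in>C. cball c (2 / b ^ m))"
    proof
      fix z assume "z \<in> graph_unit (takagi a b)"
      then obtain x where x: "0 \<le> x" "x \<le> 1" "z = (x, takagi a b x)" by (auto simp: graph_unit_def)
      define i where "i = nat \<lfloor>x * b ^ m\<rfloor>"
      have i0: "real i = of_int \<lfloor>x * b ^ m\<rfloor>" using x(1) \<open>0 < b\<close> by (simp add: i_def)
      then have i: "real i \<le> x * b ^ m" "x * b ^ m < real i + 1" by linarith+
      then have xi: "\<bar>x - real i * h\<bar> \<le> h"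
      proof -
        have "x - real i * h = (x * b ^ m - real i) * h"
          using \<open>0 < b\<close> by (simp add: h_def field_simps)
        then have "\<bar>x - real i * h\<bar> = \<bar>x * b ^ m - real i\<bar> * h" using \<open>0 < h\<close> by (simp add: abs_mult)
        moreover have "\<bar>x * b ^ m - real i\<bar> \<le> 1" using i by linarith
        ultimately show ?thesis using mult_right_mono[of "\<bar>x * b ^ m - real i\<bar>" 1 h] \<open>0 < h\<close> by simp
      qed
      have "x * b ^ m \<le> 1 * b ^ m" using x(2) \<open>0 < b\<close> by (intro mult_right_mono) auto
      then have "real i \<le> b ^ m" using i(1) by linarith
      then have "real i \<le> real (B ^ m)" by (simp add: B)
      then have "i \<in> {0..B ^ m}" by simp
      define d where "d = takagi a b x - takagi a b (real i * h)"
      define q where "q = \<lfloor>d / h\<rfloor>"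
      have "\<bar>d\<bar> \<le> H * a ^ m"
        unfolding d_def H_def using xi by (intro takagi_oscillation[OF ab]) (simp add: h_def)
      then have "\<bar>d / h\<bar> \<le> H * (a * b) ^ m"
        using \<open>0 < b\<close> by (simp add: h_def abs_mult power_mult_distrib)
      then have "q \<in> {- Q..Q}" unfolding q_def Q_def atLeastAtMost_iff by linarith
      have "of_int q \<le> d / h" "d / h < of_int q + 1" unfolding q_def by linarith+
      then have "\<bar>d - of_int q * h\<bar> \<le> h"
        using \<open>0 < h\<close> by (simp add: abs_le_iff field_simps)
      then have "dist (real i * h, takagi a b (real i * h) + of_int q * h) z \<le> h + h"
        unfolding dist_prod_def x(3) fst_conv snd_conv using xi
        by (intro order_trans[OF sqrt_sum_squares_le_sum] add_mono) (auto simp: dist_real_def d_def abs_minus_commute algebra_simps)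
      moreover have "h + h = 2 / b ^ m" by (simp add: h_def)
      ultimately show "z \<in> (\<Union>c\<in>C. cball c (2 / b ^ m))"
        unfolding C_def using \<open>i \<in> _\<close> \<open>q \<in> _\<close> by force
    qed
    then have "covering_number (2 / b ^ m) (graph_unit (takagi a b)) \<le> card C"
      by (intro covering_number_le) (simp_all add: C_def)
    also have "card C \<le> card ({0..B ^ m} \<times> {- Q..Q})" unfolding C_def by (rule card_image_le) simp
    also have "\<dots> = Suc (B ^ m) * nat (2 * Q + 1)" by simp
    finally have "real (covering_number (2 / b ^ m) (graph_unit (takagi a b))) \<le> real (Suc (B ^ m) * nat (2 * Q + 1))"
      by (rule of_nat_mono)
    also have "\<dots> = (b ^ m + 1) * (2 * of_int Q + 1)" using \<open>0 \<le> Q\<close> by (simp add: B distrib_right)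
    also have "\<dots> \<le> (2 * b ^ m) * ((2 * H + 3) * (a * b) ^ m)"
    proof (rule mult_mono)
      have "1 \<le> b ^ m" using \<open>1 < b\<close> by (intro one_le_power) simp
      then show "b ^ m + 1 \<le> 2 * b ^ m" by linarith
      have "of_int Q \<le> H * (a * b) ^ m + 1" unfolding Q_def by linarith
      moreover have "1 \<le> (a * b) ^ m" using ab by (intro one_le_power) simp
      ultimately show "2 * of_int Q + 1 \<le> (2 * H + 3) * (a * b) ^ m"
        unfolding distrib_right mult.assoc by linarith
    qed (use \<open>0 < b\<close> \<open>0 \<le> Q\<close> in auto)
    also have "\<dots> = 2 * (2 * H + 3) * (a * b * b) ^ m" by (simp add: power_mult_distrib)
    finally show ?thesis .
  qed
  then show ?thesis using that[of "2 * (2 * H + 3)"] \<open>0 < H\<close> by simp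
qed

text \<open>The exponent solves \<open>b powr s = a * b * b\<close>; radii between consecutive
  scales \<open>2 / b ^ m\<close> cost only a constant factor.\<close>

lemma upper_box_dim_graph_takagi_le:
  assumes ab: "1 < a * b" and b: "b \<in> \<nat>"
  shows "upper_box_dim (graph_unit (takagi a b)) \<le> ereal (1 + log b (a * b))"
proof -
  let ?F = "graph_unit (takagi a b)"
  define s where "s = 1 + log b (a * b)"
  have "0 < b" using ab a by (metis less_trans zero_less_mult_pos zero_less_one)
  then have "1 < b" using ab a mult_strict_right_mono[of a 1 b] by linarith
  have "0 < s" unfolding s_def using \<open>1 < b\<close> ab by (intro add_pos_pos) auto
  have bs: "b powr s = a * b * b"
    unfolding s_def powr_add using \<open>1 < b\<close> ab by simp
  obtain K where K: "0 < K" "\<And>m. real (covering_number (2 / b ^ m) ?F) \<le> K * (a * b * b) ^ m"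
    using covering_number_graph_takagi[OF ab b] by blast
  have "(0, takagi a b 0) \<in> ?F" by (simp add: graph_unit_def)
  then have ne: "?F \<noteq> {}" by blast
  have bd: "bounded ?F" using compact_graph_takagi compact_imp_bounded by blast
  show ?thesis
    unfolding s_def[symmetric]
  proof (rule upper_box_dim_le[OF ne bd])
    show "0 < K * (2 * b) powr s" using K(1) \<open>0 < b\<close> by simp
    fix r :: real assume r: "0 < r" "r < 1"
    obtain n where n: "2 / r \<le> b ^ Suc n" "b ^ n < 2 / r"
    proof -
      obtain m where "2 / r < b ^ m" using real_arch_pow[OF \<open>1 < b\<close>] by auto
      then obtain n where "n < m" "\<forall>i\<le>n. \<not> 2 / r \<le> b ^ i" "2 / r \<le> b ^ Suc n"
        using ex_least_nat_less[of "\<lambda>n. 2 / r \<le> b ^ n" m] r by auto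
      then show ?thesis using that[of n] by (auto simp: not_le)
    qed
    have "2 / b ^ Suc n \<le> r" using n(1) r \<open>0 < b\<close> by (simp add: field_simps)
    then have "covering_number r ?F \<le> covering_number (2 / b ^ Suc n) ?F"
      using \<open>0 < b\<close> by (intro covering_number_mono bd) auto
    then have "real (covering_number r ?F) \<le> real (covering_number (2 / b ^ Suc n) ?F)" by simp
    also have "\<dots> \<le> K * (a * b * b) ^ Suc n" by (rule K(2))
    also have "(a * b * b) ^ Suc n = (b ^ Suc n) powr s"
      unfolding bs[symmetric] using \<open>0 < b\<close>
      by (simp add: powr_powr mult.commute del: power_Suc flip: powr_realpow)
    also have "K * (b ^ Suc n) powr s \<le> K * (2 * b * (1 / r)) powr s"
    proof (intro mult_left_mono powr_mono2)
      show "b ^ Suc n \<le> 2 * b * (1 / r)"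
        using n(2) mult_strict_left_mono[OF n(2) \<open>0 < b\<close>] by (simp add: mult.commute)
    qed (use K(1) \<open>0 < s\<close> \<open>0 < b\<close> in auto)
    also have "\<dots> = K * (2 * b) powr s * (1 / r) powr s"
      using powr_mult[of "2 * b" "1 / r" s] by (simp only: mult.assoc)
    finally show "real (covering_number r ?F) \<le> K * (2 * b) powr s * (1 / r) powr s" .
  qed
qed

end

section \<open>The golden ratio example\<close>

lemma takagi_add_nat:
  assumes "b \<in> \<nat>"
  shows "takagi a b (x + real k) = takagi a b x"
proof -
  obtain B where B: "b = real B" using assms unfolding Nats_def by auto
  have "tent (b ^ n * (x + real k)) = tent (b ^ n * x)" for n
  proof -
    have "b ^ n * (x + real k) = b ^ n * x + of_int (int (B ^ n * k))" by (simp add: B distrib_left)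
    then show ?thesis by (simp only: tent_add_int)
  qed
  then show ?thesis by (simp add: takagi_def)
qed

text \<open>These are the numbers with \<open>n\<close> digits in base 4096, all between 8 and 15.
  For the golden ratio parameters they index the intervals from \<open>k / 4096 ^ n\<close> to
  \<open>(k + 1) / 4096 ^ n\<close> used below, on which the first \<open>3 * n\<close> terms of the
  series have constant sum.\<close>

fun flat_branches :: "nat \<Rightarrow> nat set" where
  "flat_branches 0 = {0}"
| "flat_branches (Suc n) = (\<lambda>(k, i). 4096 * k + 8 + i) ` (flat_branches n \<times> {..<8})"

lemma flat_branches_less: "k \<in> flat_branches n \<Longrightarrow> k < 4096 ^ n"
proof (induction n arbitrary: k)
  case (Suc n)
  then obtain l i where "k = 4096 * l + 8 + i" "l \<in> flat_branches n" "i < 8" by auto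
  with Suc.IH[of l] show ?case by simp
qed simp

lemma card_flat_branches: "finite (flat_branches n) \<and> card (flat_branches n) = 8 ^ n"
proof (induction n)
  case (Suc n)
  have "inj_on (\<lambda>(k, i). 4096 * k + 8 + i) (flat_branches n \<times> {..<8::nat})"
  proof (rule inj_onI, clarify)
    fix k i l j :: nat
    assume less: "i < 8" "j < 8" and eq: "4096 * k + 8 + i = 4096 * l + 8 + j"
    have "(4096 * k + 8 + i) div 4096 = k" "(4096 * l + 8 + j) div 4096 = l"
      using less by (simp_all add: add.assoc)
    then have "k = l" using eq by metis
    with eq show "k = l \<and> i = j" by simp
  qed
  with Suc show ?case by (simp add: card_image mult.commute)
qed simp

text \<open>Concatenation of digit strings: a fixed prefix of length \<open>m\<close> localises, the
  free suffix of length \<open>n\<close> branches.\<close>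

lemma flat_branches_append:
  "k \<in> flat_branches m \<Longrightarrow> l \<in> flat_branches n \<Longrightarrow> k * 4096 ^ n + l \<in> flat_branches (m + n)"
proof (induction n arbitrary: l)
  case (Suc n)
  then obtain l' i where l: "l = 4096 * l' + 8 + i" "l' \<in> flat_branches n" "i < 8" by auto
  have "k * 4096 ^ Suc n + l = 4096 * (k * 4096 ^ n + l') + 8 + i" by (simp add: l(1))
  moreover have "(k * 4096 ^ n + l', i) \<in> flat_branches (m + n) \<times> {..<8}"
    using Suc.IH[OF Suc.prems(1) l(2)] l(3) by simp
  ultimately show ?case unfolding add_Suc_right flat_branches.simps by (metis (no_types, lifting) case_prod_conv imageI)
qed simp

section \<open>Golden ratio parameters: Assouad dimension above box dimension\<close>

context
  fixes a \<phi> :: real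
  assumes phi: "1 < \<phi>" "\<phi> < 2" "\<phi>\<^sup>2 = \<phi> + 1" and a: "a = \<phi> / 16"
begin

lemma a_bounds: "0 < a" "a < 1"
  using phi a by simp_all

text \<open>On this interval \<open>x\<close> and \<open>16 * x\<close> lie on the rising side of
  the tent and \<open>256 * x\<close> on the falling side, so the slopes add up to
  \<open>1 + \<phi> - \<phi>\<^sup>2 = 0\<close>.\<close>

lemma takagi_flat_branch:
  assumes "0 \<le> y" "y \<le> 1" "i < 8"
  shows "takagi a 16 ((8 + real i + y) / 4096) = \<phi>\<^sup>2 / 256 + a ^ 3 * takagi a 16 y"
proof -
  define x where "x = (8 + real i + y) / 4096"
  have "real i \<le> 7" using assms(3) by simp
  then have x: "8 / 4096 \<le> x" "x \<le> 16 / 4096" using assms by (simp_all add: x_def)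
  have "tent x = x" using x by (intro tent_left) auto
  moreover have "tent (16 * x) = 16 * x" using x by (intro tent_left) auto
  moreover have "tent (256 * x) = 1 - 256 * x" using x by (intro tent_right) auto
  moreover have "takagi a 16 (4096 * x) = takagi a 16 y"
  proof -
    have "4096 * x = y + real (8 + i)" by (simp add: x_def)
    moreover have "(16::real) \<in> \<nat>" by simp
    ultimately show ?thesis using takagi_add_nat[of 16 a y "8 + i"] by simp
  qed
  ultimately have "takagi a 16 x = x + a * (16 * x) + a\<^sup>2 * (1 - 256 * x) + a ^ 3 * takagi a 16 y"
    using takagi_split[OF a_bounds, of 16 x 3] by (simp add: eval_nat_numeral)
  also have "x + a * (16 * x) + a\<^sup>2 * (1 - 256 * x) = \<phi>\<^sup>2 / 256 + (1 + \<phi> - \<phi>\<^sup>2) * x"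
    by (simp add: a field_simps power2_eq_square)
  finally show ?thesis using phi(3) by (simp add: x_def)
qed

text \<open>The added constant is independent of \<open>k\<close>, so all copies of one level stand
  at the same height and are horizontal translates of each other.\<close>

lemma takagi_flat_branches:
  assumes "k \<in> flat_branches n" "0 \<le> y" "y \<le> 1"
  shows "takagi a 16 ((real k + y) / 4096 ^ n) = (\<Sum>j<n. \<phi>\<^sup>2 / 256 * (a ^ 3) ^ j) + (a ^ 3) ^ n * takagi a 16 y"
  using assms
proof (induction n arbitrary: k y)
  case (Suc n)
  then obtain l i where k: "k = 4096 * l + 8 + i" "l \<in> flat_branches n" "i < 8" by auto
  define z where "z = (8 + real i + y) / 4096"
  have "real i \<le> 7" using k(3) by simp
  then have z: "0 \<le> z" "z \<le> 1" using Suc.prems by (simp_all add: z_def)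
  have "(real k + y) / 4096 ^ Suc n = (real l + z) / 4096 ^ n"
    by (simp add: k(1) z_def field_simps)
  then have "takagi a 16 ((real k + y) / 4096 ^ Suc n)
      = (\<Sum>j<n. \<phi>\<^sup>2 / 256 * (a ^ 3) ^ j) + (a ^ 3) ^ n * takagi a 16 z"
    using Suc.IH[OF k(2) z] by simp
  also have "takagi a 16 z = \<phi>\<^sup>2 / 256 + a ^ 3 * takagi a 16 y"
    unfolding z_def using takagi_flat_branch[OF Suc.prems(2,3) k(3)] .
  finally show ?case by (simp add: algebra_simps)
qed simp

lemma takagi_attains:
  assumes "0 \<le> v" "v \<le> 1/2"
  shows "\<exists>y\<in>{0..1}. takagi a 16 y = v"
proof -
  have "takagi a 16 0 = 0" by (simp add: takagi_def tent_def)
  moreover have "1/2 \<le> takagi a 16 (1/2)"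
    using takagi_split[OF a_bounds, of 16 "1/2" 1] takagi_nonneg[OF a_bounds, of 16 "16 * (1/2)"]
      tent_left[of "1/2"] a_bounds by simp
  ultimately have "\<exists>y\<ge>0. y \<le> 1/2 \<and> takagi a 16 y = v"
    using assms by (intro IVT' continuous_on_takagi[OF a_bounds]) auto
  then show ?thesis by force
qed

text \<open>Inside one branch of level \<open>m\<close> there are \<open>8 ^ n\<close> translated
  copies of level \<open>m + n\<close>. For large \<open>m\<close> each is tall enough to cross
  \<open>4096 ^ n\<close> horizontal lines at spacing \<open>\<delta>\<close>, the width of a copy,
  and the crossings form a separated set.\<close>

lemma graph_takagi_separated_points:
  obtains R x where "0 < R" "x \<in> graph_unit (takagi a 16)"
    "8 ^ n * 4096 ^ n \<le> covering_number (R / (6 * 4096 ^ n)) (cball x R \<inter> graph_unit (takagi a 16))"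
proof -
  let ?F = "graph_unit (takagi a 16)"
  define A where "A = a ^ 3"
  have A: "0 < A" using a_bounds by (simp add: A_def)
  have phi3: "4096 * A = \<phi> ^ 3" by (simp add: A_def a power_divide)
  have "1 < \<phi> ^ 3" using phi(1) by (intro one_less_power) auto
  \<comment> \<open>As \<open>4096 * A = \<phi> ^ 3 > 1\<close>, copies become ever more elongated.
    This \<open>m\<close> makes those of level \<open>m + n\<close> at least as tall as a branch of
    level \<open>m\<close> is wide.\<close>
  then obtain m where "2 / A ^ n < (\<phi> ^ 3) ^ m" using real_arch_pow by blast
  then have m: "1 / 4096 ^ m \<le> A ^ (m + n) / 2"
    using A by (simp add: phi3[symmetric] power_mult_distrib power_add field_simps)
  define \<delta> :: real where "\<delta> = 1 / 4096 ^ (m + n)"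
  have "0 < \<delta>" by (simp add: \<delta>_def)
  have delta_eq: "4096 ^ n * \<delta> = 1 / 4096 ^ m" by (simp add: \<delta>_def power_add)
  obtain k0 where k0: "k0 \<in> flat_branches m"
    using card_flat_branches[of m] by (metis all_not_in_conv card.empty power_not_zero zero_neq_numeral)
  obtain l0 where l0: "l0 \<in> flat_branches n"
    using card_flat_branches[of n] by (metis all_not_in_conv card.empty power_not_zero zero_neq_numeral)
  \<comment> \<open>The parameter at which a copy reaches the \<open>q\<close>-th line depends only
    on \<open>q\<close>, so it serves all branches.\<close>
  have "\<exists>y. 0 \<le> y \<and> y \<le> 1 \<and> A ^ (m + n) * takagi a 16 y = real q * \<delta>" if "q < 4096 ^ n" for q
  proof -
    have "real q \<le> real (4096 ^ n)" using that by (intro of_nat_mono) simp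
    then have "real q * \<delta> \<le> 4096 ^ n * \<delta>" using \<open>0 < \<delta>\<close> by (intro mult_right_mono) auto
    also have "\<dots> \<le> A ^ (m + n) / 2" using m delta_eq by simp
    finally have "real q * \<delta> / A ^ (m + n) \<le> 1/2" using A by (simp add: field_simps)
    moreover have "0 \<le> real q * \<delta> / A ^ (m + n)" using A \<open>0 < \<delta>\<close> by simp
    ultimately obtain y where "y \<in> {0..1}" "takagi a 16 y = real q * \<delta> / A ^ (m + n)"
      using takagi_attains by blast
    then show ?thesis using A by (intro exI[of _ y]) simp
  qed
  then obtain y where y: "\<And>q. q < 4096 ^ n \<Longrightarrow> 0 \<le> y q \<and> y q \<le> 1 \<and> A ^ (m + n) * takagi a 16 (y q) = real q * \<delta>"
    by metis
  define H where "H = (\<Sum>j<m + n. \<phi>\<^sup>2 / 256 * (a ^ 3) ^ j)"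
  define p where "p = (\<lambda>(q, l). ((real (k0 * 4096 ^ n + l) + y q) * \<delta>, H + real q * \<delta>))"
  define I where "I = {..<4096 ^ n :: nat} \<times> flat_branches n"
  \<comment> \<open>The points spread by at most \<open>4096 ^ n * \<delta>\<close> in each
    coordinate; \<open>R\<close> is the sum of both bounds.\<close>
  define R where "R = 2 / (4096 ^ m :: real)"
  define x where "x = p (0, l0)"
  have R_eq: "R = 2 * (4096 ^ n * \<delta>)" by (simp add: R_def delta_eq)
  have "(0, l0) \<in> I" using l0 by (simp add: I_def)
  have pF: "p w \<in> ?F" if "w \<in> I" for w
  proof -
    obtain q l where w: "w = (q, l)" "q < 4096 ^ n" "l \<in> flat_branches n"
      using \<open>w \<in> I\<close> by (auto simp: I_def)
    define k where "k = k0 * 4096 ^ n + l"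
    have k: "k \<in> flat_branches (m + n)" unfolding k_def using flat_branches_append[OF k0 w(3)] .
    then have "Suc k \<le> 4096 ^ (m + n)" using flat_branches_less by (simp add: Suc_le_eq)
    then have "real (Suc k) \<le> 4096 ^ (m + n)" by (metis of_nat_le_iff of_nat_numeral of_nat_power)
    then have "(real k + y q) * \<delta> \<le> 1" "0 \<le> (real k + y q) * \<delta>"
      using y[OF w(2)] by (simp_all add: \<delta>_def)
    moreover have "takagi a 16 ((real k + y q) * \<delta>) = H + real q * \<delta>"
      using takagi_flat_branches[OF k, of "y q"] y[OF w(2)] by (simp add: \<delta>_def H_def A_def)
    ultimately show ?thesis by (simp add: w(1) p_def graph_unit_def k_def)
  qed
  \<comment> \<open>Points on different lines are \<open>\<delta>\<close> apart vertically. Points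
    on one line share \<open>y q\<close>, so distinct branches separate them horizontally.\<close>
  have sep: "\<delta> \<le> dist (p w) (p w')" if ww: "w \<in> I" "w' \<in> I" "w \<noteq> w'" for w w'
  proof -
    obtain q l q' l' where w: "w = (q, l)" "w' = (q', l')" by (metis surj_pair)
    have nat_sep: "\<delta> \<le> \<bar>real i - real j\<bar> * \<delta>" if "i \<noteq> j" for i j :: nat
      using that mult_right_mono[of 1 "\<bar>real i - real j\<bar>" \<delta>] \<open>0 < \<delta>\<close> by simp
    show ?thesis
    proof (cases "q = q'")
      case True
      have "dist (fst (p w)) (fst (p w')) = \<bar>(real l - real l') * \<delta>\<bar>"
        unfolding dist_real_def by (simp add: p_def w True algebra_simps)
      also have "\<dots> = \<bar>real l - real l'\<bar> * \<delta>" using \<open>0 < \<delta>\<close> by (simp add: abs_mult)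
      finally show ?thesis
        using nat_sep[of l l'] dist_fst_le[of "p w" "p w'"] ww(3) True w by simp
    next
      case False
      have "dist (snd (p w)) (snd (p w')) = \<bar>(real q - real q') * \<delta>\<bar>"
        unfolding dist_real_def by (simp add: p_def w algebra_simps)
      also have "\<dots> = \<bar>real q - real q'\<bar> * \<delta>" using \<open>0 < \<delta>\<close> by (simp add: abs_mult)
      finally show ?thesis
        using nat_sep[OF False] dist_snd_le[of "p w" "p w'"] by simp
    qed
  qed
  have near: "dist x (p w) \<le> R" if "w \<in> I" for w
  proof -
    obtain q l where w: "w = (q, l)" "q < 4096 ^ n" "l \<in> flat_branches n"
      using \<open>w \<in> I\<close> by (auto simp: I_def)
    have in_range: "0 \<le> real l + y q \<and> real l + y q \<le> 4096 ^ n"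
      if "q < 4096 ^ n" "l \<in> flat_branches n" for q l
    proof -
      have "Suc l \<le> 4096 ^ n" using flat_branches_less[OF that(2)] by simp
      then have "real (Suc l) \<le> 4096 ^ n" by (metis of_nat_le_iff of_nat_numeral of_nat_power)
      then show ?thesis using y[OF that(1)] by simp
    qed
    have "dist (fst x) (fst (p w)) = \<bar>((real l0 + y 0) - (real l + y q)) * \<delta>\<bar>"
      unfolding dist_real_def by (simp add: x_def p_def w(1) algebra_simps)
    also have "\<dots> = \<bar>(real l0 + y 0) - (real l + y q)\<bar> * \<delta>" using \<open>0 < \<delta>\<close> by (simp add: abs_mult)
    also have "\<dots> \<le> 4096 ^ n * \<delta>"
      using in_range[OF w(2,3)] in_range[OF _ l0, of 0] \<open>0 < \<delta>\<close> by (intro mult_right_mono) auto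
    finally have 1: "dist (fst x) (fst (p w)) \<le> 4096 ^ n * \<delta>" .
    have "real q \<le> real (4096 ^ n)" using w(2) by (intro of_nat_mono) simp
    then have 2: "dist (snd x) (snd (p w)) \<le> 4096 ^ n * \<delta>"
      using \<open>0 < \<delta>\<close> by (simp add: dist_real_def x_def p_def w(1))
    have "dist x (p w) \<le> dist (fst x) (fst (p w)) + dist (snd x) (snd (p w))"
      unfolding dist_prod_def by (intro sqrt_sum_squares_le_sum) auto
    then show ?thesis using 1 2 by (simp add: R_eq)
  qed
  have "inj_on p I"
  proof (rule inj_onI, rule ccontr)
    fix w w' assume "w \<in> I" "w' \<in> I" "p w = p w'" "w \<noteq> w'"
    then show False using sep[of w w'] \<open>0 < \<delta>\<close> by simp
  qed
  then have "card (p ` I) = 8 ^ n * 4096 ^ n"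
    using card_flat_branches[of n] by (simp add: card_image I_def)
  moreover have "card (p ` I) \<le> covering_number (\<delta> / 3) (cball x R \<inter> ?F)"
  proof (rule card_separated_le_covering_number)
    show "p ` I \<subseteq> cball x R \<inter> ?F" using near pF by auto
    show "bounded (cball x R \<inter> ?F)" by (simp add: bounded_Int)
    fix u v assume "u \<in> p ` I" "v \<in> p ` I" "u \<noteq> v"
    then have "\<delta> \<le> dist u v" using sep by blast
    then show "2 * (\<delta> / 3) < dist u v" using \<open>0 < \<delta>\<close> by simp
  qed (use \<open>0 < \<delta>\<close> in simp)
  moreover have "R / (6 * 4096 ^ n) = \<delta> / 3" by (simp add: R_eq)
  moreover have "0 < R" by (simp add: R_def)
  moreover have "x \<in> ?F" unfolding x_def using pF \<open>(0, l0) \<in> I\<close> .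
  ultimately show ?thesis using that[of R x] by (simp only:)
qed

text \<open>At the ratio \<open>6 * 2 ^ (12 * n)\<close> of radii the count is at least
  \<open>2 ^ (15 * n)\<close>, so no exponent below \<open>15 / 12\<close> is admissible.\<close>

lemma assouad_dim_graph_takagi_ge: "ereal (5/4) \<le> assouad_dim (graph_unit (takagi a 16))"
  unfolding assouad_dim_def
proof (rule Inf_greatest, clarify)
  let ?F = "graph_unit (takagi a 16)"
  fix s C :: real
  assume "0 \<le> s" and C: "0 < C" "\<forall>R>0. \<forall>r\<in>{0<..<R}. \<forall>x\<in>?F.
      real (covering_number r (cball x R \<inter> ?F)) \<le> C * (R / r) powr s"
  have "5/4 \<le> s"
  proof (rule ccontr)
    assume "\<not> 5/4 \<le> s"
    then have "1 < 2 powr (15 - 12 * s)" by simp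
    then obtain n where n: "C * 6 powr s < (2 powr (15 - 12 * s)) ^ n"
      using real_arch_pow by blast
    obtain R x where R: "0 < R" and x: "x \<in> ?F"
      and le: "8 ^ n * 4096 ^ n \<le> covering_number (R / (6 * 4096 ^ n)) (cball x R \<inter> ?F)"
      using graph_takagi_separated_points .
    have "(1::real) \<le> 4096 ^ n" by simp
    then have "(1::real) < 6 * 4096 ^ n" by linarith
    then have r: "R / (6 * 4096 ^ n) \<in> {0<..<R}" using R by (simp add: divide_less_eq)
    have "(2::real) powr (15 * real n) = 8 ^ n * 4096 ^ n"
    proof -
      have "(8::real) ^ n * 4096 ^ n = (2 ^ 15) ^ n" by (simp flip: power_mult_distrib)
      also have "\<dots> = 2 ^ (15 * n)" by (simp only: power_mult)
      finally show ?thesis by (simp flip: powr_realpow)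
    qed
    also have "\<dots> = real (8 ^ n * 4096 ^ n)" by simp
    also have "\<dots> \<le> real (covering_number (R / (6 * 4096 ^ n)) (cball x R \<inter> ?F))"
      using le by (rule of_nat_mono)
    also have "\<dots> \<le> C * (R / (R / (6 * 4096 ^ n))) powr s"
      using C(2) R r x by blast
    also have "R / (R / (6 * 4096 ^ n)) = 6 * 4096 ^ n" using R by simp
    also have "(6 * 4096 ^ n) powr s = 6 powr s * 2 powr (12 * s * real n)"
    proof -
      have "(4096::real) ^ n = 2 ^ (12 * n)" by (simp add: power_mult)
      also have "\<dots> = 2 powr (12 * real n)" by (simp flip: powr_realpow)
      finally show ?thesis by (simp add: powr_mult powr_powr mult_ac)
    qed
    also have "C * (6 powr s * 2 powr (12 * s * real n)) < (2 powr (15 - 12 * s)) ^ n * 2 powr (12 * s * real n)"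
      unfolding mult.assoc[symmetric] using n by (intro mult_strict_right_mono) auto
    also have "\<dots> = 2 powr (15 * real n)"
    proof -
      have "(2 powr (15 - 12 * s)) ^ n = 2 powr ((15 - 12 * s) * real n)"
        by (simp add: powr_powr flip: powr_realpow)
      then show ?thesis by (simp add: algebra_simps flip: powr_add)
    qed
    finally show False by simp
  qed
  then show "ereal (5/4) \<le> ereal s" by simp
qed

text \<open>The gap comes from \<open>\<phi> < 2\<close>, since
  \<open>log 16 2 = 1/4\<close>.\<close>

lemma upper_box_dim_less_assouad_dim_takagi:
  "upper_box_dim (graph_unit (takagi a 16)) < assouad_dim (graph_unit (takagi a 16))"
proof -
  have "upper_box_dim (graph_unit (takagi a 16)) \<le> ereal (1 + log 16 (a * 16))"
    using phi a by (intro upper_box_dim_graph_takagi_le a_bounds) auto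
  also have "log 16 (a * 16) < log 16 2" using phi a by simp
  then have "ereal (1 + log 16 (a * 16)) < ereal (1 + log 16 2)" by simp
  also have "log 16 2 = (1/4 :: real)"
  proof -
    have "ln (16::real) = ln (2 ^ 4)" by simp
    also have "\<dots> = 4 * ln 2" by (subst ln_realpow) auto
    finally show ?thesis by (simp add: log_def)
  qed
  also have "ereal (1 + 1/4) = ereal (5/4)" by simp
  also have "\<dots> \<le> assouad_dim (graph_unit (takagi a 16))" by (rule assouad_dim_graph_takagi_ge)
  finally show ?thesis .
qed

lemma takagi_condition_golden: "takagi_condition a 16"
proof -
  define \<epsilon> :: "nat \<Rightarrow> real" where "\<epsilon> n = (if n = 2 then -1 else 1)" for n
  have "(\<Sum>n<3. \<epsilon> n * (a * 16) ^ n) = 0"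
    using phi(3) by (simp add: \<epsilon>_def a eval_nat_numeral)
  moreover have "\<forall>n<3. \<epsilon> n \<in> {-1, 1}" by (simp add: \<epsilon>_def)
  moreover have "(16::real) \<in> \<int>" by simp
  ultimately show ?thesis
    unfolding takagi_condition_def using a_bounds phi(1) a
    by (intro conjI exI[of _ "3::nat"] exI[of _ \<epsilon>]) auto
qed

end

theorem lemma1p2:
  shows "(\<forall>(a::real) (b::real) (X::(real \<times> real) set).
            takagi_condition a b \<and> (X = cball 0 1 \<or> X = cbox 0 One) \<longrightarrow>
            (\<exists>E. weak_tangent X E (graph_unit (takagi a b)) \<and>
                 hausdorff_dim E = assouad_dim (graph_unit (takagi a b)) \<and>
                 assouad_dim (graph_unit (takagi a b)) \<ge> upper_box_dim (graph_unit (takagi a b))))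
       \<and> (\<exists>(a::real) (b::real). takagi_condition a b \<and>
            assouad_dim (graph_unit (takagi a b)) > upper_box_dim (graph_unit (takagi a b)))"
proof (rule conjI; (intro allI impI)?)
  fix a b :: real and X :: "(real \<times> real) set"
  assume asm: "takagi_condition a b \<and> (X = cball 0 1 \<or> X = cbox 0 One)"
  then have ab: "a < 1" "1 < a * b" "2 < b" by (auto simp: takagi_condition_def)
  \<comment> \<open>Positivity of \<open>a\<close> is not stated in \<open>takagi_condition\<close>;
    it follows from \<open>a * b > 1\<close> and \<open>b > 2\<close>.\<close>
  have "0 < a * b" using ab(2) by simp
  then have "0 < a" using ab(3) by (simp add: zero_less_mult_iff)
  let ?F = "graph_unit (takagi a b)"
  have F: "compact ?F" using \<open>0 < a\<close> ab(1) by (rule compact_graph_takagi)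
  have "(0, takagi a b 0) \<in> ?F" by (simp add: graph_unit_def)
  then have ne: "?F \<noteq> {}" by blast
  have X: "compact X" using asm by auto
  have square: "{0..1/2} \<times> {0..1/2} \<subseteq> X"
  proof
    fix z :: "real \<times> real" assume "z \<in> {0..1/2} \<times> {0..1/2}"
    then obtain u v where z: "z = (u, v)" "0 \<le> u" "u \<le> 1/2" "0 \<le> v" "v \<le> 1/2" by auto
    have "norm z \<le> norm u + norm v" unfolding z(1) by (rule norm_Pair_le)
    then have "norm z \<le> 1" using z by simp
    then have "z \<in> cball 0 1" by simp
    moreover have "z \<in> cbox 0 One"
      using z by (auto simp: mem_box Basis_prod_def inner_sum_left)
    ultimately show "z \<in> X" using asm by blast
  qed
  obtain E where "weak_tangent X E ?F" "hausdorff_dim E = assouad_dim ?F"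
    using exists_weak_tangent_of_full_dimension[OF F ne X square] .
  then show "\<exists>E. weak_tangent X E ?F \<and> hausdorff_dim E = assouad_dim ?F \<and> upper_box_dim ?F \<le> assouad_dim ?F"
    using upper_box_dim_le_assouad_dim[OF ne compact_imp_bounded[OF F]] by blast
next
  define \<phi> :: real where "\<phi> = (1 + sqrt 5) / 2"
  have "1 < sqrt 5" "sqrt 5 < 3" by (auto intro: real_less_rsqrt real_less_lsqrt)
  then have "1 < \<phi>" "\<phi> < 2" by (simp_all add: \<phi>_def)
  moreover have "\<phi>\<^sup>2 = \<phi> + 1" by (simp add: \<phi>_def power2_eq_square field_simps)
  ultimately show "\<exists>a b. takagi_condition a b \<and> upper_box_dim (graph_unit (takagi a b)) < assouad_dim (graph_unit (takagi a b))"
    using takagi_condition_golden[of \<phi>] upper_box_dim_less_assouad_dim_takagi[of \<phi>] by blast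
qed

end
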